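(* Each of the following principles on its own implies Rosolini choice (i.e. for all $P,Q:\mathcal U$, $\operatorname{isRosolini}(P)\to(P\to\lVert\operatorname{rosoliniStructure}(Q)\rVert)\to\lVert P\to\operatorname{rosoliniStructure}(Q)\rVert$): (1) countable choice; (2) for every type $A$ and every $\alpha:\mathbb N\to2$, $\big(\prod_{n}\lVert(\alpha_n=1)\to A\rVert\big)\to\lVert\prod_n((\alpha_n=1)\to A)\rVert$; (3) untruncated LPO: $\prod_{\alpha:\mathbb N\to 2}\big(\langle\alpha\rangle+(\alpha=\lambda n.0)\big)$; (4) untruncated WLPO: $\prod_{\alpha:\mathbb N\to2}\big(\langle\alpha\rangle+\neg\langle\alpha\rangle\big)$; (5) truncated WLPO: $\prod_{\alpha:\mathbb N\to2}\lVert\langle\alpha\rangle+\neg\langle\alpha\rangle\rVert$; (6) propositional choice: for all $P,A:\mathcal U$ with $A$ a set and $P$ a proposition, $(P\to\lVert A\rVert)\to\lVert P\to A\rVert$.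
   Context: Type theory: Martin-Löf type theory with universe $\mathcal U$, function extensionality, proposition extensionality and propositional truncations $\lVert X\rVert$. For $\alpha:\mathbb N\to 2$ let $\langle\alpha\rangle:=\sum_{n:\mathbb N}(\alpha_n=1)$; $\mathbb N_\infty:=\sum_{\alpha:\mathbb N\to2}\operatorname{isProp}(\langle\alpha\rangle)$, and for $u:\mathbb N_\infty$, $\langle u\rangle$ is $\langle\alpha\rangle$ of its underlying sequence. $\operatorname{rosoliniStructure}(P):=\sum_{u:\mathbb N_\infty}(P=\langle u\rangle)$ and $\operatorname{isRosolini}(P):=\lVert\operatorname{rosoliniStructure}(P)\rVert$. Countable choice: for every family $Y:\mathbb N\to\mathcal U$, $\big(\prod_{n}\lVert Y(n)\rVert\big)\to\lVert\prod_n Y(n)\rVert$. A set is a type whose identity types are propositions. *)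

theory Defs
  imports Main
begin

text \<open>
  The claim is about derivability in intensional Martin-Loef type theory, so the type theory is
  given as a deep embedding (de Bruijn syntax with inductively defined judgements). In a shallow
  rendering the binders would range over arbitrary functions of the classical meta-logic, and all
  the choice and omniscience principles below would hold outright.

  The theory has a cumulative Russell-style hierarchy of universes, dependent products and sums
  (both with eta), binary sums, the types 0, 1, 2 and N, identity types, propositional
  truncations, function extensionality and proposition extensionality. A hierarchy is needed since
  the identity type \<open>P = Q\<close> of two elements of a universe lives in the next universe.
\<close>

section \<open>Syntax\<close>

text \<open>
  Variables bound in the last-listed position have index 0. Binding structure: the second argument
  of \<open>Pi\<close>, \<open>Lam\<close> and \<open>Sg\<close> binds one variable; the motives (first
  arguments) of \<open>Case\<close>, \<open>Abort\<close>, \<open>UnitInd\<close>,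
  \<open>TwoInd\<close> and \<open>NatInd\<close>, and both branches of \<open>Case\<close>, bind one
  variable; the step of \<open>NatInd\<close> binds two (the predecessor has index 1, the recursive
  value index 0); the motive of \<open>J\<close> (its third argument) binds two (the endpoint has index
  1, the path index 0).
\<close>

datatype tm =
    Var nat
  | Univ nat
  | Pi tm tm | Lam tm tm | App tm tm
  | Sg tm tm | Pr tm tm | Fst tm | Snd tm
  | Plus tm tm | InjL tm | InjR tm | Case tm tm tm tm
  | Empty | Abort tm tm
  | Unit | Star | UnitInd tm tm tm
  | Two | Zero2 | One2 | TwoInd tm tm tm tm
  | Nat | Zero | Succ tm | NatInd tm tm tm tm
  | Idt tm tm tm | Refl tm | J tm tm tm tm tm tm
  | Trunc tm | Inc tm | Squash tm tm | TruncRec tm tm tm tm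
  | Funext tm tm tm
  | Propext tm tm tm tm tm tm

definition upren :: "(nat \<Rightarrow> nat) \<Rightarrow> nat \<Rightarrow> nat" where
  "upren r = case_nat 0 (\<lambda>k. Suc (r k))"

primrec ren :: "(nat \<Rightarrow> nat) \<Rightarrow> tm \<Rightarrow> tm" where
  "ren r (Var k) = Var (r k)"
| "ren r (Univ l) = Univ l"
| "ren r (Pi A B) = Pi (ren r A) (ren (upren r) B)"
| "ren r (Lam A b) = Lam (ren r A) (ren (upren r) b)"
| "ren r (App f a) = App (ren r f) (ren r a)"
| "ren r (Sg A B) = Sg (ren r A) (ren (upren r) B)"
| "ren r (Pr a b) = Pr (ren r a) (ren r b)"
| "ren r (Fst p) = Fst (ren r p)"
| "ren r (Snd p) = Snd (ren r p)"
| "ren r (Plus A B) = Plus (ren r A) (ren r B)"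
| "ren r (InjL a) = InjL (ren r a)"
| "ren r (InjR b) = InjR (ren r b)"
| "ren r (Case C c d s) = Case (ren (upren r) C) (ren (upren r) c) (ren (upren r) d) (ren r s)"
| "ren r Empty = Empty"
| "ren r (Abort C s) = Abort (ren (upren r) C) (ren r s)"
| "ren r Unit = Unit"
| "ren r Star = Star"
| "ren r (UnitInd C c s) = UnitInd (ren (upren r) C) (ren r c) (ren r s)"
| "ren r Two = Two"
| "ren r Zero2 = Zero2"
| "ren r One2 = One2"
| "ren r (TwoInd C c d s) = TwoInd (ren (upren r) C) (ren r c) (ren r d) (ren r s)"
| "ren r Nat = Nat"
| "ren r Zero = Zero"
| "ren r (Succ n) = Succ (ren r n)"
| "ren r (NatInd C c d n) =
     NatInd (ren (upren r) C) (ren r c) (ren (upren (upren r)) d) (ren r n)"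
| "ren r (Idt A a b) = Idt (ren r A) (ren r a) (ren r b)"
| "ren r (Refl a) = Refl (ren r a)"
| "ren r (J A a C c b p) =
     J (ren r A) (ren r a) (ren (upren (upren r)) C) (ren r c) (ren r b) (ren r p)"
| "ren r (Trunc A) = Trunc (ren r A)"
| "ren r (Inc a) = Inc (ren r a)"
| "ren r (Squash a b) = Squash (ren r a) (ren r b)"
| "ren r (TruncRec B h f x) = TruncRec (ren r B) (ren r h) (ren r f) (ren r x)"
| "ren r (Funext f g h) = Funext (ren r f) (ren r g) (ren r h)"
| "ren r (Propext P Q p q f g) =
     Propext (ren r P) (ren r Q) (ren r p) (ren r q) (ren r f) (ren r g)"

abbreviation wk :: "tm \<Rightarrow> tm" where
  "wk \<equiv> ren Suc"

definition scons :: "tm \<Rightarrow> (nat \<Rightarrow> tm) \<Rightarrow> nat \<Rightarrow> tm" where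
  "scons a s = case_nat a s"

definition up :: "(nat \<Rightarrow> tm) \<Rightarrow> nat \<Rightarrow> tm" where
  "up s = scons (Var 0) (\<lambda>k. wk (s k))"

primrec subst :: "(nat \<Rightarrow> tm) \<Rightarrow> tm \<Rightarrow> tm" where
  "subst s (Var k) = s k"
| "subst s (Univ l) = Univ l"
| "subst s (Pi A B) = Pi (subst s A) (subst (up s) B)"
| "subst s (Lam A b) = Lam (subst s A) (subst (up s) b)"
| "subst s (App f a) = App (subst s f) (subst s a)"
| "subst s (Sg A B) = Sg (subst s A) (subst (up s) B)"
| "subst s (Pr a b) = Pr (subst s a) (subst s b)"
| "subst s (Fst p) = Fst (subst s p)"
| "subst s (Snd p) = Snd (subst s p)"
| "subst s (Plus A B) = Plus (subst s A) (subst s B)"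
| "subst s (InjL a) = InjL (subst s a)"
| "subst s (InjR b) = InjR (subst s b)"
| "subst s (Case C c d t) =
     Case (subst (up s) C) (subst (up s) c) (subst (up s) d) (subst s t)"
| "subst s Empty = Empty"
| "subst s (Abort C t) = Abort (subst (up s) C) (subst s t)"
| "subst s Unit = Unit"
| "subst s Star = Star"
| "subst s (UnitInd C c t) = UnitInd (subst (up s) C) (subst s c) (subst s t)"
| "subst s Two = Two"
| "subst s Zero2 = Zero2"
| "subst s One2 = One2"
| "subst s (TwoInd C c d t) = TwoInd (subst (up s) C) (subst s c) (subst s d) (subst s t)"
| "subst s Nat = Nat"
| "subst s Zero = Zero"
| "subst s (Succ n) = Succ (subst s n)"
| "subst s (NatInd C c d n) =
     NatInd (subst (up s) C) (subst s c) (subst (up (up s)) d) (subst s n)"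
| "subst s (Idt A a b) = Idt (subst s A) (subst s a) (subst s b)"
| "subst s (Refl a) = Refl (subst s a)"
| "subst s (J A a C c b p) =
     J (subst s A) (subst s a) (subst (up (up s)) C) (subst s c) (subst s b) (subst s p)"
| "subst s (Trunc A) = Trunc (subst s A)"
| "subst s (Inc a) = Inc (subst s a)"
| "subst s (Squash a b) = Squash (subst s a) (subst s b)"
| "subst s (TruncRec B h f x) = TruncRec (subst s B) (subst s h) (subst s f) (subst s x)"
| "subst s (Funext f g h) = Funext (subst s f) (subst s g) (subst s h)"
| "subst s (Propext P Q p q f g) =
     Propext (subst s P) (subst s Q) (subst s p) (subst s q) (subst s f) (subst s g)"

definition inst :: "tm \<Rightarrow> tm \<Rightarrow> tm" where
  "inst t a = subst (scons a Var) t"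

text \<open>\<open>inst2 t a b\<close> puts \<open>a\<close> for index 1 and \<open>b\<close> for index 0.\<close>

definition inst2 :: "tm \<Rightarrow> tm \<Rightarrow> tm \<Rightarrow> tm" where
  "inst2 t a b = subst (scons b (scons a Var)) t"

definition arr :: "tm \<Rightarrow> tm \<Rightarrow> tm"  (infixr "\<rightarrow>\<^sub>t" 60) where
  "A \<rightarrow>\<^sub>t B = Pi A (wk B)"

definition isProp :: "tm \<Rightarrow> tm" where
  "isProp A = Pi A (Pi (wk A) (Idt (wk (wk A)) (Var 1) (Var 0)))"


section \<open>Judgements\<close>

text \<open>
  Contexts are lists of types, innermost first. A type is a term of type \<open>Univ l\<close> for some
  \<open>l\<close>. The rules \<open>ty_subst\<close> and \<open>eq_subst\<close> are the usual structural
  rules of weakening and substitution, stated once for simultaneous substitutions. The eliminator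
  \<open>J\<close> is based path induction. No computation
  rule is imposed on truncation, and the two extensionality principles are stated in their weak
  form (pointwise equal functions are equal, logically equivalent propositions are equal).
\<close>

inductive
  ctx :: "tm list \<Rightarrow> bool"  ("\<turnstile> _" [40] 40) and
  has_ty :: "tm list \<Rightarrow> tm \<Rightarrow> tm \<Rightarrow> bool"  ("_ \<turnstile> _ \<^bold>: _" [40, 40, 40] 40) and
  eq_tm :: "tm list \<Rightarrow> tm \<Rightarrow> tm \<Rightarrow> tm \<Rightarrow> bool"
    ("_ \<turnstile> _ \<^bold>\<equiv> _ \<^bold>: _" [40, 40, 40, 40] 40)
where
  ctx_nil: "\<turnstile> []"
| ctx_cons: "\<Gamma> \<turnstile> A \<^bold>: Univ l \<Longrightarrow> \<turnstile> A # \<Gamma>"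

| ty_var: "\<lbrakk>\<turnstile> \<Gamma>; k < length \<Gamma>\<rbrakk> \<Longrightarrow> \<Gamma> \<turnstile> Var k \<^bold>: ren (\<lambda>m. m + Suc k) (\<Gamma> ! k)"
| ty_conv: "\<lbrakk>\<Gamma> \<turnstile> a \<^bold>: A; \<Gamma> \<turnstile> A \<^bold>\<equiv> B \<^bold>: Univ l\<rbrakk> \<Longrightarrow> \<Gamma> \<turnstile> a \<^bold>: B"
| ty_subst: "\<lbrakk>\<Gamma> \<turnstile> a \<^bold>: A; \<turnstile> \<Delta>;
    \<And>k. k < length \<Gamma> \<Longrightarrow> \<Delta> \<turnstile> s k \<^bold>: subst s (ren (\<lambda>m. m + Suc k) (\<Gamma> ! k))\<rbrakk>
    \<Longrightarrow> \<Delta> \<turnstile> subst s a \<^bold>: subst s A"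
| eq_refl: "\<Gamma> \<turnstile> a \<^bold>: A \<Longrightarrow> \<Gamma> \<turnstile> a \<^bold>\<equiv> a \<^bold>: A"
| eq_sym: "\<Gamma> \<turnstile> a \<^bold>\<equiv> b \<^bold>: A \<Longrightarrow> \<Gamma> \<turnstile> b \<^bold>\<equiv> a \<^bold>: A"
| eq_trans: "\<lbrakk>\<Gamma> \<turnstile> a \<^bold>\<equiv> b \<^bold>: A; \<Gamma> \<turnstile> b \<^bold>\<equiv> c \<^bold>: A\<rbrakk> \<Longrightarrow> \<Gamma> \<turnstile> a \<^bold>\<equiv> c \<^bold>: A"
| eq_conv: "\<lbrakk>\<Gamma> \<turnstile> a \<^bold>\<equiv> b \<^bold>: A; \<Gamma> \<turnstile> A \<^bold>\<equiv> B \<^bold>: Univ l\<rbrakk> \<Longrightarrow> \<Gamma> \<turnstile> a \<^bold>\<equiv> b \<^bold>: B"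
| eq_subst: "\<lbrakk>\<Gamma> \<turnstile> a \<^bold>\<equiv> b \<^bold>: A; \<turnstile> \<Delta>;
    \<And>k. k < length \<Gamma> \<Longrightarrow> \<Delta> \<turnstile> s k \<^bold>: subst s (ren (\<lambda>m. m + Suc k) (\<Gamma> ! k))\<rbrakk>
    \<Longrightarrow> \<Delta> \<turnstile> subst s a \<^bold>\<equiv> subst s b \<^bold>: subst s A"

| ty_univ: "\<turnstile> \<Gamma> \<Longrightarrow> \<Gamma> \<turnstile> Univ l \<^bold>: Univ (Suc l)"
| ty_cumul: "\<Gamma> \<turnstile> A \<^bold>: Univ l \<Longrightarrow> \<Gamma> \<turnstile> A \<^bold>: Univ (Suc l)"
| eq_cumul: "\<Gamma> \<turnstile> A \<^bold>\<equiv> B \<^bold>: Univ l \<Longrightarrow> \<Gamma> \<turnstile> A \<^bold>\<equiv> B \<^bold>: Univ (Suc l)"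

| ty_Pi: "\<lbrakk>\<Gamma> \<turnstile> A \<^bold>: Univ l; A # \<Gamma> \<turnstile> B \<^bold>: Univ l\<rbrakk> \<Longrightarrow> \<Gamma> \<turnstile> Pi A B \<^bold>: Univ l"
| ty_Lam: "A # \<Gamma> \<turnstile> b \<^bold>: B \<Longrightarrow> \<Gamma> \<turnstile> Lam A b \<^bold>: Pi A B"
| ty_App: "\<lbrakk>\<Gamma> \<turnstile> f \<^bold>: Pi A B; \<Gamma> \<turnstile> a \<^bold>: A\<rbrakk> \<Longrightarrow> \<Gamma> \<turnstile> App f a \<^bold>: inst B a"
| eq_Pi: "\<lbrakk>\<Gamma> \<turnstile> A \<^bold>\<equiv> A' \<^bold>: Univ l; A # \<Gamma> \<turnstile> B \<^bold>\<equiv> B' \<^bold>: Univ l\<rbrakk>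
    \<Longrightarrow> \<Gamma> \<turnstile> Pi A B \<^bold>\<equiv> Pi A' B' \<^bold>: Univ l"
| eq_Lam: "\<lbrakk>\<Gamma> \<turnstile> A \<^bold>\<equiv> A' \<^bold>: Univ l; A # \<Gamma> \<turnstile> b \<^bold>\<equiv> b' \<^bold>: B\<rbrakk>
    \<Longrightarrow> \<Gamma> \<turnstile> Lam A b \<^bold>\<equiv> Lam A' b' \<^bold>: Pi A B"
| eq_App: "\<lbrakk>\<Gamma> \<turnstile> f \<^bold>\<equiv> f' \<^bold>: Pi A B; \<Gamma> \<turnstile> a \<^bold>\<equiv> a' \<^bold>: A\<rbrakk>
    \<Longrightarrow> \<Gamma> \<turnstile> App f a \<^bold>\<equiv> App f' a' \<^bold>: inst B a"
| Pi_beta: "\<lbrakk>A # \<Gamma> \<turnstile> b \<^bold>: B; \<Gamma> \<turnstile> a \<^bold>: A\<rbrakk>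
    \<Longrightarrow> \<Gamma> \<turnstile> App (Lam A b) a \<^bold>\<equiv> inst b a \<^bold>: inst B a"
| Pi_eta: "\<Gamma> \<turnstile> f \<^bold>: Pi A B \<Longrightarrow> \<Gamma> \<turnstile> Lam A (App (wk f) (Var 0)) \<^bold>\<equiv> f \<^bold>: Pi A B"

| ty_Sg: "\<lbrakk>\<Gamma> \<turnstile> A \<^bold>: Univ l; A # \<Gamma> \<turnstile> B \<^bold>: Univ l\<rbrakk> \<Longrightarrow> \<Gamma> \<turnstile> Sg A B \<^bold>: Univ l"
| ty_Pr: "\<lbrakk>A # \<Gamma> \<turnstile> B \<^bold>: Univ l; \<Gamma> \<turnstile> a \<^bold>: A; \<Gamma> \<turnstile> b \<^bold>: inst B a\<rbrakk> \<Longrightarrow> \<Gamma> \<turnstile> Pr a b \<^bold>: Sg A B"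
| ty_Fst: "\<Gamma> \<turnstile> p \<^bold>: Sg A B \<Longrightarrow> \<Gamma> \<turnstile> Fst p \<^bold>: A"
| ty_Snd: "\<Gamma> \<turnstile> p \<^bold>: Sg A B \<Longrightarrow> \<Gamma> \<turnstile> Snd p \<^bold>: inst B (Fst p)"
| eq_Sg: "\<lbrakk>\<Gamma> \<turnstile> A \<^bold>\<equiv> A' \<^bold>: Univ l; A # \<Gamma> \<turnstile> B \<^bold>\<equiv> B' \<^bold>: Univ l\<rbrakk>
    \<Longrightarrow> \<Gamma> \<turnstile> Sg A B \<^bold>\<equiv> Sg A' B' \<^bold>: Univ l"
| eq_Pr: "\<lbrakk>A # \<Gamma> \<turnstile> B \<^bold>: Univ l; \<Gamma> \<turnstile> a \<^bold>\<equiv> a' \<^bold>: A; \<Gamma> \<turnstile> b \<^bold>\<equiv> b' \<^bold>: inst B a\<rbrakk>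
    \<Longrightarrow> \<Gamma> \<turnstile> Pr a b \<^bold>\<equiv> Pr a' b' \<^bold>: Sg A B"
| eq_Fst: "\<Gamma> \<turnstile> p \<^bold>\<equiv> p' \<^bold>: Sg A B \<Longrightarrow> \<Gamma> \<turnstile> Fst p \<^bold>\<equiv> Fst p' \<^bold>: A"
| eq_Snd: "\<Gamma> \<turnstile> p \<^bold>\<equiv> p' \<^bold>: Sg A B \<Longrightarrow> \<Gamma> \<turnstile> Snd p \<^bold>\<equiv> Snd p' \<^bold>: inst B (Fst p)"
| Fst_beta: "\<lbrakk>A # \<Gamma> \<turnstile> B \<^bold>: Univ l; \<Gamma> \<turnstile> a \<^bold>: A; \<Gamma> \<turnstile> b \<^bold>: inst B a\<rbrakk>
    \<Longrightarrow> \<Gamma> \<turnstile> Fst (Pr a b) \<^bold>\<equiv> a \<^bold>: A"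
| Snd_beta: "\<lbrakk>A # \<Gamma> \<turnstile> B \<^bold>: Univ l; \<Gamma> \<turnstile> a \<^bold>: A; \<Gamma> \<turnstile> b \<^bold>: inst B a\<rbrakk>
    \<Longrightarrow> \<Gamma> \<turnstile> Snd (Pr a b) \<^bold>\<equiv> b \<^bold>: inst B a"
| Sg_eta: "\<Gamma> \<turnstile> p \<^bold>: Sg A B \<Longrightarrow> \<Gamma> \<turnstile> Pr (Fst p) (Snd p) \<^bold>\<equiv> p \<^bold>: Sg A B"

| ty_Plus: "\<lbrakk>\<Gamma> \<turnstile> A \<^bold>: Univ l; \<Gamma> \<turnstile> B \<^bold>: Univ l\<rbrakk> \<Longrightarrow> \<Gamma> \<turnstile> Plus A B \<^bold>: Univ l"
| ty_InjL: "\<lbrakk>\<Gamma> \<turnstile> a \<^bold>: A; \<Gamma> \<turnstile> B \<^bold>: Univ l\<rbrakk> \<Longrightarrow> \<Gamma> \<turnstile> InjL a \<^bold>: Plus A B"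
| ty_InjR: "\<lbrakk>\<Gamma> \<turnstile> A \<^bold>: Univ l; \<Gamma> \<turnstile> b \<^bold>: B\<rbrakk> \<Longrightarrow> \<Gamma> \<turnstile> InjR b \<^bold>: Plus A B"
| ty_Case: "\<lbrakk>Plus A B # \<Gamma> \<turnstile> C \<^bold>: Univ l;
    A # \<Gamma> \<turnstile> c \<^bold>: subst (scons (InjL (Var 0)) (\<lambda>k. Var (Suc k))) C;
    B # \<Gamma> \<turnstile> d \<^bold>: subst (scons (InjR (Var 0)) (\<lambda>k. Var (Suc k))) C;
    \<Gamma> \<turnstile> t \<^bold>: Plus A B\<rbrakk>
    \<Longrightarrow> \<Gamma> \<turnstile> Case C c d t \<^bold>: inst C t"
| eq_Plus: "\<lbrakk>\<Gamma> \<turnstile> A \<^bold>\<equiv> A' \<^bold>: Univ l; \<Gamma> \<turnstile> B \<^bold>\<equiv> B' \<^bold>: Univ l\<rbrakk>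
    \<Longrightarrow> \<Gamma> \<turnstile> Plus A B \<^bold>\<equiv> Plus A' B' \<^bold>: Univ l"
| eq_InjL: "\<lbrakk>\<Gamma> \<turnstile> a \<^bold>\<equiv> a' \<^bold>: A; \<Gamma> \<turnstile> B \<^bold>: Univ l\<rbrakk> \<Longrightarrow> \<Gamma> \<turnstile> InjL a \<^bold>\<equiv> InjL a' \<^bold>: Plus A B"
| eq_InjR: "\<lbrakk>\<Gamma> \<turnstile> A \<^bold>: Univ l; \<Gamma> \<turnstile> b \<^bold>\<equiv> b' \<^bold>: B\<rbrakk> \<Longrightarrow> \<Gamma> \<turnstile> InjR b \<^bold>\<equiv> InjR b' \<^bold>: Plus A B"
| eq_Case: "\<lbrakk>Plus A B # \<Gamma> \<turnstile> C \<^bold>\<equiv> C' \<^bold>: Univ l;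
    A # \<Gamma> \<turnstile> c \<^bold>\<equiv> c' \<^bold>: subst (scons (InjL (Var 0)) (\<lambda>k. Var (Suc k))) C;
    B # \<Gamma> \<turnstile> d \<^bold>\<equiv> d' \<^bold>: subst (scons (InjR (Var 0)) (\<lambda>k. Var (Suc k))) C;
    \<Gamma> \<turnstile> t \<^bold>\<equiv> t' \<^bold>: Plus A B\<rbrakk>
    \<Longrightarrow> \<Gamma> \<turnstile> Case C c d t \<^bold>\<equiv> Case C' c' d' t' \<^bold>: inst C t"
| InjL_beta: "\<lbrakk>Plus A B # \<Gamma> \<turnstile> C \<^bold>: Univ l;
    A # \<Gamma> \<turnstile> c \<^bold>: subst (scons (InjL (Var 0)) (\<lambda>k. Var (Suc k))) C;
    B # \<Gamma> \<turnstile> d \<^bold>: subst (scons (InjR (Var 0)) (\<lambda>k. Var (Suc k))) C;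
    \<Gamma> \<turnstile> a \<^bold>: A\<rbrakk>
    \<Longrightarrow> \<Gamma> \<turnstile> Case C c d (InjL a) \<^bold>\<equiv> inst c a \<^bold>: inst C (InjL a)"
| InjR_beta: "\<lbrakk>Plus A B # \<Gamma> \<turnstile> C \<^bold>: Univ l;
    A # \<Gamma> \<turnstile> c \<^bold>: subst (scons (InjL (Var 0)) (\<lambda>k. Var (Suc k))) C;
    B # \<Gamma> \<turnstile> d \<^bold>: subst (scons (InjR (Var 0)) (\<lambda>k. Var (Suc k))) C;
    \<Gamma> \<turnstile> b \<^bold>: B\<rbrakk>
    \<Longrightarrow> \<Gamma> \<turnstile> Case C c d (InjR b) \<^bold>\<equiv> inst d b \<^bold>: inst C (InjR b)"

| ty_Empty: "\<turnstile> \<Gamma> \<Longrightarrow> \<Gamma> \<turnstile> Empty \<^bold>: Univ l"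
| ty_Abort: "\<lbrakk>Empty # \<Gamma> \<turnstile> C \<^bold>: Univ l; \<Gamma> \<turnstile> t \<^bold>: Empty\<rbrakk> \<Longrightarrow> \<Gamma> \<turnstile> Abort C t \<^bold>: inst C t"
| eq_Abort: "\<lbrakk>Empty # \<Gamma> \<turnstile> C \<^bold>\<equiv> C' \<^bold>: Univ l; \<Gamma> \<turnstile> t \<^bold>\<equiv> t' \<^bold>: Empty\<rbrakk>
    \<Longrightarrow> \<Gamma> \<turnstile> Abort C t \<^bold>\<equiv> Abort C' t' \<^bold>: inst C t"

| ty_Unit: "\<turnstile> \<Gamma> \<Longrightarrow> \<Gamma> \<turnstile> Unit \<^bold>: Univ l"
| ty_Star: "\<turnstile> \<Gamma> \<Longrightarrow> \<Gamma> \<turnstile> Star \<^bold>: Unit"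
| ty_UnitInd: "\<lbrakk>Unit # \<Gamma> \<turnstile> C \<^bold>: Univ l; \<Gamma> \<turnstile> c \<^bold>: inst C Star; \<Gamma> \<turnstile> t \<^bold>: Unit\<rbrakk>
    \<Longrightarrow> \<Gamma> \<turnstile> UnitInd C c t \<^bold>: inst C t"
| eq_UnitInd: "\<lbrakk>Unit # \<Gamma> \<turnstile> C \<^bold>\<equiv> C' \<^bold>: Univ l; \<Gamma> \<turnstile> c \<^bold>\<equiv> c' \<^bold>: inst C Star; \<Gamma> \<turnstile> t \<^bold>\<equiv> t' \<^bold>: Unit\<rbrakk>
    \<Longrightarrow> \<Gamma> \<turnstile> UnitInd C c t \<^bold>\<equiv> UnitInd C' c' t' \<^bold>: inst C t"
| Star_beta: "\<lbrakk>Unit # \<Gamma> \<turnstile> C \<^bold>: Univ l; \<Gamma> \<turnstile> c \<^bold>: inst C Star\<rbrakk>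
    \<Longrightarrow> \<Gamma> \<turnstile> UnitInd C c Star \<^bold>\<equiv> c \<^bold>: inst C Star"

| ty_Two: "\<turnstile> \<Gamma> \<Longrightarrow> \<Gamma> \<turnstile> Two \<^bold>: Univ l"
| ty_Zero2: "\<turnstile> \<Gamma> \<Longrightarrow> \<Gamma> \<turnstile> Zero2 \<^bold>: Two"
| ty_One2: "\<turnstile> \<Gamma> \<Longrightarrow> \<Gamma> \<turnstile> One2 \<^bold>: Two"
| ty_TwoInd: "\<lbrakk>Two # \<Gamma> \<turnstile> C \<^bold>: Univ l; \<Gamma> \<turnstile> c \<^bold>: inst C Zero2; \<Gamma> \<turnstile> d \<^bold>: inst C One2; \<Gamma> \<turnstile> t \<^bold>: Two\<rbrakk>
    \<Longrightarrow> \<Gamma> \<turnstile> TwoInd C c d t \<^bold>: inst C t"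
| eq_TwoInd: "\<lbrakk>Two # \<Gamma> \<turnstile> C \<^bold>\<equiv> C' \<^bold>: Univ l; \<Gamma> \<turnstile> c \<^bold>\<equiv> c' \<^bold>: inst C Zero2;
    \<Gamma> \<turnstile> d \<^bold>\<equiv> d' \<^bold>: inst C One2; \<Gamma> \<turnstile> t \<^bold>\<equiv> t' \<^bold>: Two\<rbrakk>
    \<Longrightarrow> \<Gamma> \<turnstile> TwoInd C c d t \<^bold>\<equiv> TwoInd C' c' d' t' \<^bold>: inst C t"
| Zero2_beta: "\<lbrakk>Two # \<Gamma> \<turnstile> C \<^bold>: Univ l; \<Gamma> \<turnstile> c \<^bold>: inst C Zero2; \<Gamma> \<turnstile> d \<^bold>: inst C One2\<rbrakk>
    \<Longrightarrow> \<Gamma> \<turnstile> TwoInd C c d Zero2 \<^bold>\<equiv> c \<^bold>: inst C Zero2"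
| One2_beta: "\<lbrakk>Two # \<Gamma> \<turnstile> C \<^bold>: Univ l; \<Gamma> \<turnstile> c \<^bold>: inst C Zero2; \<Gamma> \<turnstile> d \<^bold>: inst C One2\<rbrakk>
    \<Longrightarrow> \<Gamma> \<turnstile> TwoInd C c d One2 \<^bold>\<equiv> d \<^bold>: inst C One2"

| ty_Nat: "\<turnstile> \<Gamma> \<Longrightarrow> \<Gamma> \<turnstile> Nat \<^bold>: Univ l"
| ty_Zero: "\<turnstile> \<Gamma> \<Longrightarrow> \<Gamma> \<turnstile> Zero \<^bold>: Nat"
| ty_Succ: "\<Gamma> \<turnstile> n \<^bold>: Nat \<Longrightarrow> \<Gamma> \<turnstile> Succ n \<^bold>: Nat"
| ty_NatInd: "\<lbrakk>Nat # \<Gamma> \<turnstile> C \<^bold>: Univ l; \<Gamma> \<turnstile> c \<^bold>: inst C Zero;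
    C # Nat # \<Gamma> \<turnstile> d \<^bold>: subst (scons (Succ (Var 1)) (\<lambda>k. Var (k + 2))) C; \<Gamma> \<turnstile> n \<^bold>: Nat\<rbrakk>
    \<Longrightarrow> \<Gamma> \<turnstile> NatInd C c d n \<^bold>: inst C n"
| eq_Succ: "\<Gamma> \<turnstile> n \<^bold>\<equiv> n' \<^bold>: Nat \<Longrightarrow> \<Gamma> \<turnstile> Succ n \<^bold>\<equiv> Succ n' \<^bold>: Nat"
| eq_NatInd: "\<lbrakk>Nat # \<Gamma> \<turnstile> C \<^bold>\<equiv> C' \<^bold>: Univ l; \<Gamma> \<turnstile> c \<^bold>\<equiv> c' \<^bold>: inst C Zero;
    C # Nat # \<Gamma> \<turnstile> d \<^bold>\<equiv> d' \<^bold>: subst (scons (Succ (Var 1)) (\<lambda>k. Var (k + 2))) C; \<Gamma> \<turnstile> n \<^bold>\<equiv> n' \<^bold>: Nat\<rbrakk>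
    \<Longrightarrow> \<Gamma> \<turnstile> NatInd C c d n \<^bold>\<equiv> NatInd C' c' d' n' \<^bold>: inst C n"
| Zero_beta: "\<lbrakk>Nat # \<Gamma> \<turnstile> C \<^bold>: Univ l; \<Gamma> \<turnstile> c \<^bold>: inst C Zero;
    C # Nat # \<Gamma> \<turnstile> d \<^bold>: subst (scons (Succ (Var 1)) (\<lambda>k. Var (k + 2))) C\<rbrakk>
    \<Longrightarrow> \<Gamma> \<turnstile> NatInd C c d Zero \<^bold>\<equiv> c \<^bold>: inst C Zero"
| Succ_beta: "\<lbrakk>Nat # \<Gamma> \<turnstile> C \<^bold>: Univ l; \<Gamma> \<turnstile> c \<^bold>: inst C Zero;
    C # Nat # \<Gamma> \<turnstile> d \<^bold>: subst (scons (Succ (Var 1)) (\<lambda>k. Var (k + 2))) C; \<Gamma> \<turnstile> n \<^bold>: Nat\<rbrakk>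
    \<Longrightarrow> \<Gamma> \<turnstile> NatInd C c d (Succ n) \<^bold>\<equiv> inst2 d n (NatInd C c d n) \<^bold>: inst C (Succ n)"

| ty_Idt: "\<lbrakk>\<Gamma> \<turnstile> A \<^bold>: Univ l; \<Gamma> \<turnstile> a \<^bold>: A; \<Gamma> \<turnstile> b \<^bold>: A\<rbrakk> \<Longrightarrow> \<Gamma> \<turnstile> Idt A a b \<^bold>: Univ l"
| ty_Refl: "\<Gamma> \<turnstile> a \<^bold>: A \<Longrightarrow> \<Gamma> \<turnstile> Refl a \<^bold>: Idt A a a"
| ty_J: "\<lbrakk>\<Gamma> \<turnstile> a \<^bold>: A; Idt (wk A) (wk a) (Var 0) # A # \<Gamma> \<turnstile> C \<^bold>: Univ l;
    \<Gamma> \<turnstile> c \<^bold>: inst2 C a (Refl a); \<Gamma> \<turnstile> b \<^bold>: A; \<Gamma> \<turnstile> p \<^bold>: Idt A a b\<rbrakk>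
    \<Longrightarrow> \<Gamma> \<turnstile> J A a C c b p \<^bold>: inst2 C b p"
| eq_Idt: "\<lbrakk>\<Gamma> \<turnstile> A \<^bold>\<equiv> A' \<^bold>: Univ l; \<Gamma> \<turnstile> a \<^bold>\<equiv> a' \<^bold>: A; \<Gamma> \<turnstile> b \<^bold>\<equiv> b' \<^bold>: A\<rbrakk>
    \<Longrightarrow> \<Gamma> \<turnstile> Idt A a b \<^bold>\<equiv> Idt A' a' b' \<^bold>: Univ l"
| eq_Refl: "\<Gamma> \<turnstile> a \<^bold>\<equiv> a' \<^bold>: A \<Longrightarrow> \<Gamma> \<turnstile> Refl a \<^bold>\<equiv> Refl a' \<^bold>: Idt A a a"
| eq_J: "\<lbrakk>\<Gamma> \<turnstile> A \<^bold>\<equiv> A' \<^bold>: Univ m; \<Gamma> \<turnstile> a \<^bold>\<equiv> a' \<^bold>: A;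
    Idt (wk A) (wk a) (Var 0) # A # \<Gamma> \<turnstile> C \<^bold>\<equiv> C' \<^bold>: Univ l;
    \<Gamma> \<turnstile> c \<^bold>\<equiv> c' \<^bold>: inst2 C a (Refl a); \<Gamma> \<turnstile> b \<^bold>\<equiv> b' \<^bold>: A; \<Gamma> \<turnstile> p \<^bold>\<equiv> p' \<^bold>: Idt A a b\<rbrakk>
    \<Longrightarrow> \<Gamma> \<turnstile> J A a C c b p \<^bold>\<equiv> J A' a' C' c' b' p' \<^bold>: inst2 C b p"
| J_beta: "\<lbrakk>\<Gamma> \<turnstile> a \<^bold>: A; Idt (wk A) (wk a) (Var 0) # A # \<Gamma> \<turnstile> C \<^bold>: Univ l;
    \<Gamma> \<turnstile> c \<^bold>: inst2 C a (Refl a)\<rbrakk>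
    \<Longrightarrow> \<Gamma> \<turnstile> J A a C c a (Refl a) \<^bold>\<equiv> c \<^bold>: inst2 C a (Refl a)"

| ty_Trunc: "\<Gamma> \<turnstile> A \<^bold>: Univ l \<Longrightarrow> \<Gamma> \<turnstile> Trunc A \<^bold>: Univ l"
| ty_Inc: "\<Gamma> \<turnstile> a \<^bold>: A \<Longrightarrow> \<Gamma> \<turnstile> Inc a \<^bold>: Trunc A"
| ty_Squash: "\<lbrakk>\<Gamma> \<turnstile> x \<^bold>: Trunc A; \<Gamma> \<turnstile> y \<^bold>: Trunc A\<rbrakk> \<Longrightarrow> \<Gamma> \<turnstile> Squash x y \<^bold>: Idt (Trunc A) x y"
| ty_TruncRec: "\<lbrakk>\<Gamma> \<turnstile> B \<^bold>: Univ l; \<Gamma> \<turnstile> h \<^bold>: isProp B; \<Gamma> \<turnstile> f \<^bold>: A \<rightarrow>\<^sub>t B; \<Gamma> \<turnstile> x \<^bold>: Trunc A\<rbrakk>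
    \<Longrightarrow> \<Gamma> \<turnstile> TruncRec B h f x \<^bold>: B"
| eq_Trunc: "\<Gamma> \<turnstile> A \<^bold>\<equiv> A' \<^bold>: Univ l \<Longrightarrow> \<Gamma> \<turnstile> Trunc A \<^bold>\<equiv> Trunc A' \<^bold>: Univ l"
| eq_Inc: "\<Gamma> \<turnstile> a \<^bold>\<equiv> a' \<^bold>: A \<Longrightarrow> \<Gamma> \<turnstile> Inc a \<^bold>\<equiv> Inc a' \<^bold>: Trunc A"
| eq_Squash: "\<lbrakk>\<Gamma> \<turnstile> x \<^bold>\<equiv> x' \<^bold>: Trunc A; \<Gamma> \<turnstile> y \<^bold>\<equiv> y' \<^bold>: Trunc A\<rbrakk>
    \<Longrightarrow> \<Gamma> \<turnstile> Squash x y \<^bold>\<equiv> Squash x' y' \<^bold>: Idt (Trunc A) x y"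
| eq_TruncRec: "\<lbrakk>\<Gamma> \<turnstile> B \<^bold>\<equiv> B' \<^bold>: Univ l; \<Gamma> \<turnstile> h \<^bold>\<equiv> h' \<^bold>: isProp B; \<Gamma> \<turnstile> f \<^bold>\<equiv> f' \<^bold>: A \<rightarrow>\<^sub>t B;
    \<Gamma> \<turnstile> x \<^bold>\<equiv> x' \<^bold>: Trunc A\<rbrakk>
    \<Longrightarrow> \<Gamma> \<turnstile> TruncRec B h f x \<^bold>\<equiv> TruncRec B' h' f' x' \<^bold>: B"

| ty_Funext: "\<lbrakk>\<Gamma> \<turnstile> f \<^bold>: Pi A B; \<Gamma> \<turnstile> g \<^bold>: Pi A B;
    \<Gamma> \<turnstile> h \<^bold>: Pi A (Idt B (App (wk f) (Var 0)) (App (wk g) (Var 0)))\<rbrakk>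
    \<Longrightarrow> \<Gamma> \<turnstile> Funext f g h \<^bold>: Idt (Pi A B) f g"
| eq_Funext: "\<lbrakk>\<Gamma> \<turnstile> f \<^bold>\<equiv> f' \<^bold>: Pi A B; \<Gamma> \<turnstile> g \<^bold>\<equiv> g' \<^bold>: Pi A B;
    \<Gamma> \<turnstile> h \<^bold>\<equiv> h' \<^bold>: Pi A (Idt B (App (wk f) (Var 0)) (App (wk g) (Var 0)))\<rbrakk>
    \<Longrightarrow> \<Gamma> \<turnstile> Funext f g h \<^bold>\<equiv> Funext f' g' h' \<^bold>: Idt (Pi A B) f g"

| ty_Propext: "\<lbrakk>\<Gamma> \<turnstile> P \<^bold>: Univ l; \<Gamma> \<turnstile> Q \<^bold>: Univ l; \<Gamma> \<turnstile> p \<^bold>: isProp P; \<Gamma> \<turnstile> q \<^bold>: isProp Q;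
    \<Gamma> \<turnstile> f \<^bold>: P \<rightarrow>\<^sub>t Q; \<Gamma> \<turnstile> g \<^bold>: Q \<rightarrow>\<^sub>t P\<rbrakk>
    \<Longrightarrow> \<Gamma> \<turnstile> Propext P Q p q f g \<^bold>: Idt (Univ l) P Q"
| eq_Propext: "\<lbrakk>\<Gamma> \<turnstile> P \<^bold>\<equiv> P' \<^bold>: Univ l; \<Gamma> \<turnstile> Q \<^bold>\<equiv> Q' \<^bold>: Univ l; \<Gamma> \<turnstile> p \<^bold>\<equiv> p' \<^bold>: isProp P;
    \<Gamma> \<turnstile> q \<^bold>\<equiv> q' \<^bold>: isProp Q; \<Gamma> \<turnstile> f \<^bold>\<equiv> f' \<^bold>: P \<rightarrow>\<^sub>t Q; \<Gamma> \<turnstile> g \<^bold>\<equiv> g' \<^bold>: Q \<rightarrow>\<^sub>t P\<rbrakk>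
    \<Longrightarrow> \<Gamma> \<turnstile> Propext P Q p q f g \<^bold>\<equiv> Propext P' Q' p' q' f' g' \<^bold>: Idt (Univ l) P Q"

definition provable :: "tm \<Rightarrow> bool" where
  "provable A \<longleftrightarrow> (\<exists>t. [] \<turnstile> t \<^bold>: A)"


section \<open>The notions and principles of the statement\<close>

definition neg :: "tm \<Rightarrow> tm" where
  "neg A = (A \<rightarrow>\<^sub>t Empty)"

definition isSet :: "tm \<Rightarrow> tm" where
  "isSet A = Pi A (Pi (wk A) (isProp (Idt (wk (wk A)) (Var 1) (Var 0))))"

definition Cantor :: tm where
  "Cantor = (Nat \<rightarrow>\<^sub>t Two)"

text \<open>\<open>holds_at \<alpha> n\<close> is the type \<open>\<alpha>\<^sub>n = 1\<close>, and
  \<open>extent \<alpha>\<close> is the type written with angle brackets around \<open>\<alpha>\<close>.\<close>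

definition holds_at :: "tm \<Rightarrow> tm \<Rightarrow> tm" where
  "holds_at \<alpha> n = Idt Two (App \<alpha> n) One2"

definition extent :: "tm \<Rightarrow> tm" where
  "extent \<alpha> = Sg Nat (holds_at (wk \<alpha>) (Var 0))"

definition Ninf :: tm where
  "Ninf = Sg Cantor (isProp (extent (Var 0)))"

text \<open>
  In the following, \<open>l\<close> is the level of the ambient universe. The \<open>let\<close>
  names stand for de Bruijn indices; where \<open>n\<close> occurs, all indices are those valid
  below the binder of \<open>Pi Nat\<close>. The function arrow does its own weakening.
\<close>

definition rosoliniStructure :: "nat \<Rightarrow> tm \<Rightarrow> tm" where
  "rosoliniStructure l P = Sg Ninf (Idt (Univ l) (wk P) (extent (Fst (Var 0))))"

definition isRosolini :: "nat \<Rightarrow> tm \<Rightarrow> tm" where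
  "isRosolini l P = Trunc (rosoliniStructure l P)"

definition RosoliniChoice :: "nat \<Rightarrow> tm" where
  "RosoliniChoice l =
     Pi (Univ l) (Pi (Univ l)
       (let P = Var 1; Q = Var 0 in
         isRosolini l P \<rightarrow>\<^sub>t (P \<rightarrow>\<^sub>t Trunc (rosoliniStructure l Q)) \<rightarrow>\<^sub>t
         Trunc (P \<rightarrow>\<^sub>t rosoliniStructure l Q)))"

definition CountableChoice :: "nat \<Rightarrow> tm" where
  "CountableChoice l =
     Pi (Nat \<rightarrow>\<^sub>t Univ l)
       (let Y = Var 1; n = Var 0 in
         Pi Nat (Trunc (App Y n)) \<rightarrow>\<^sub>t Trunc (Pi Nat (App Y n)))"

definition SemidecidableChoice :: "nat \<Rightarrow> tm" where
  "SemidecidableChoice l =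
     Pi (Univ l) (Pi Cantor
       (let A = Var 2; \<alpha> = Var 1; n = Var 0 in
         Pi Nat (Trunc (holds_at \<alpha> n \<rightarrow>\<^sub>t A)) \<rightarrow>\<^sub>t Trunc (Pi Nat (holds_at \<alpha> n \<rightarrow>\<^sub>t A))))"

definition LPO :: tm where
  "LPO = Pi Cantor (let \<alpha> = Var 0 in Plus (extent \<alpha>) (Idt Cantor \<alpha> (Lam Nat Zero2)))"

definition WLPO :: tm where
  "WLPO = Pi Cantor (let \<alpha> = Var 0 in Plus (extent \<alpha>) (neg (extent \<alpha>)))"

definition TruncatedWLPO :: tm where
  "TruncatedWLPO = Pi Cantor (let \<alpha> = Var 0 in Trunc (Plus (extent \<alpha>) (neg (extent \<alpha>))))"

definition PropositionalChoice :: "nat \<Rightarrow> tm" where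
  "PropositionalChoice l =
     Pi (Univ l) (Pi (Univ l)
       (let P = Var 1; A = Var 0 in
         isSet A \<rightarrow>\<^sub>t isProp P \<rightarrow>\<^sub>t (P \<rightarrow>\<^sub>t Trunc A) \<rightarrow>\<^sub>t Trunc (P \<rightarrow>\<^sub>t A)))"

end

theory Submission
  imports Defs
begin

text \<open>
  A Rosolini proposition equals the extent of a binary sequence \<open>\<alpha>\<close>, so Rosolini choice reduces
  to choice over extents. Truncated WLPO, which follows from LPO and from WLPO, decides the extent
  up to truncation, and choice over a decidable type is trivial. Principle (2) applies after
  currying, since each \<open>\<alpha>\<^sub>n = 1\<close> is decidable, and it follows from countable choice for the
  family \<open>(\<alpha>\<^sub>n = 1) \<rightarrow> A\<close>.

  The Rosolini structures on \<open>Q\<close> form a type in the next universe, so one first replaces them by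
  the small type of all \<open>u\<close> for which \<open>Q\<close> is a proposition equivalent to the extent of \<open>u\<close>; by
  proposition extensionality the two are logically equivalent. For propositional choice this type
  must be a set. Hedberg's argument, for relations valued in propositions, shows that the type 2 is
  a set and that sets are closed under dependent products and subtypes.
\<close>

section \<open>Renaming and substitution\<close>

abbreviation v0 :: tm where "v0 \<equiv> Var 0"
abbreviation v1 :: tm where "v1 \<equiv> Var (Suc 0)"
abbreviation v2 :: tm where "v2 \<equiv> Var (Suc (Suc 0))"
abbreviation v3 :: tm where "v3 \<equiv> Var (Suc (Suc (Suc 0)))"

abbreviation wk_under :: "tm \<Rightarrow> tm" where
  "wk_under \<equiv> ren (upren Suc)"

lemma upren_simps [simp]: "upren r 0 = 0" "upren r (Suc k) = Suc (r k)"
  by (simp_all add: upren_def)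

lemma scons_simps [simp]: "scons a s 0 = a" "scons a s (Suc k) = s k"
  by (simp_all add: scons_def)

lemma up_simps [simp]: "up s 0 = v0" "up s (Suc k) = wk (s k)"
  by (simp_all add: up_def)

lemma fun_eq_nat_iff: "f = g \<longleftrightarrow> f 0 = g 0 \<and> (\<forall>k. f (Suc k) = g (Suc k))" for f g :: "nat \<Rightarrow> 'a"
  by (metis ext not0_implies_Suc)

lemma upren_id: "upren (\<lambda>k. k) = (\<lambda>k. k)"
  by (simp add: fun_eq_nat_iff)

lemma upren_comp: "(\<lambda>k. upren r (upren r' k)) = upren (\<lambda>k. r (r' k))"
  by (simp add: fun_eq_nat_iff)

lemma up_upren: "(\<lambda>k. up s (upren r k)) = up (\<lambda>k. s (r k))"
  by (simp add: fun_eq_nat_iff)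

lemma up_Var: "up (\<lambda>k. Var (r k)) = (\<lambda>k. Var (upren r k))"
  by (simp add: fun_eq_nat_iff)

lemma ren_id [simp]: "ren (\<lambda>k. k) t = t"
  by (induction t) (simp_all add: upren_id)

lemma ren_ren: "ren r (ren r' t) = ren (\<lambda>k. r (r' k)) t"
  by (induction t arbitrary: r r') (simp_all add: upren_comp)

lemma subst_ren: "subst s (ren r t) = subst (\<lambda>k. s (r k)) t"
  by (induction t arbitrary: s r) (simp_all add: up_upren)

lemma ren_up: "(\<lambda>k. ren (upren r) (up s k)) = up (\<lambda>k. ren r (s k))"
  by (simp add: fun_eq_nat_iff ren_ren)

lemma ren_subst: "ren r (subst s t) = subst (\<lambda>k. ren r (s k)) t"
  by (induction t arbitrary: s r) (simp_all add: ren_up)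

lemma subst_Var_ren: "subst (\<lambda>k. Var (r k)) t = ren r t"
  by (induction t arbitrary: r) (simp_all add: up_Var)

lemma subst_Var [simp]: "subst Var t = t"
  using subst_Var_ren[of "\<lambda>k. k" t] by simp

lemma up_Var_id [simp]: "up Var = Var"
  by (simp add: fun_eq_nat_iff)

lemma ren_upren_wk [simp]: "ren (upren r) (wk t) = wk (ren r t)"
  by (simp add: ren_ren)

lemma subst_up_wk [simp]: "subst (up s) (wk t) = wk (subst s t)"
  by (simp add: subst_ren ren_subst)

lemma subst_scons_wk [simp]: "subst (scons a s) (wk t) = subst s t"
  by (simp add: subst_ren)

lemma subst_scons_wk_under [simp]: "subst (scons v0 Var) (wk_under t) = t"
proof -
  have "(\<lambda>k. scons v0 Var (upren Suc k)) = Var"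
    by (simp add: fun_eq_nat_iff)
  then show ?thesis by (simp add: subst_ren)
qed

lemma subst_v1_wk_under_wk_under [simp]: "subst (scons v1 Var) (wk_under (wk_under t)) = wk t"
proof -
  have "(\<lambda>k. scons v1 Var (upren Suc (upren Suc k))) = (\<lambda>k. Var (Suc k))"
    by (simp add: fun_eq_nat_iff)
  then show ?thesis by (simp add: subst_ren subst_Var_ren)
qed

lemma subst_up_scons_wk_under [simp]: "subst (up (scons a s)) (wk_under t) = subst (up s) t"
  by (simp add: subst_ren up_upren)

lemma subst_up_up_wk_under [simp]: "subst (up (up s)) (wk_under t) = wk_under (subst (up s) t)"
  by (simp add: subst_ren ren_subst up_upren ren_up)

lemma inst_wk [simp]: "inst (wk t) a = t"
  by (simp add: inst_def)

lemma inst2_wk [simp]: "inst2 (wk t) a b = inst t a"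
  by (simp add: inst_def inst2_def)

lemma ren_inst: "ren r (inst t a) = inst (ren (upren r) t) (ren r a)"
proof -
  have "(\<lambda>k. ren r (scons a Var k)) = (\<lambda>k. scons (ren r a) Var (upren r k))"
    by (simp add: fun_eq_nat_iff)
  then show ?thesis by (simp add: inst_def ren_subst subst_ren)
qed

definition times :: "tm \<Rightarrow> tm \<Rightarrow> tm"  (infixr "\<times>\<^sub>t" 65) where
  "A \<times>\<^sub>t B = Sg A (wk B)"

definition iff :: "tm \<Rightarrow> tm \<Rightarrow> tm"  (infix "\<leftrightarrow>\<^sub>t" 55) where
  "A \<leftrightarrow>\<^sub>t B = (A \<rightarrow>\<^sub>t B) \<times>\<^sub>t (B \<rightarrow>\<^sub>t A)"

definition decidable :: "tm \<Rightarrow> tm" where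
  "decidable A = Plus A (neg A)"

lemmas type_former_defs = arr_def times_def iff_def isProp_def isSet_def neg_def decidable_def
  Cantor_def holds_at_def extent_def Ninf_def rosoliniStructure_def

lemma ren_type_formers [simp]:
  "ren r (A \<rightarrow>\<^sub>t B) = ren r A \<rightarrow>\<^sub>t ren r B"
  "ren r (A \<times>\<^sub>t B) = ren r A \<times>\<^sub>t ren r B"
  "ren r (A \<leftrightarrow>\<^sub>t B) = ren r A \<leftrightarrow>\<^sub>t ren r B"
  "ren r (isProp A) = isProp (ren r A)"
  "ren r (isSet A) = isSet (ren r A)"
  "ren r (neg A) = neg (ren r A)"
  "ren r (decidable A) = decidable (ren r A)"
  "ren r Cantor = Cantor"
  "ren r (holds_at a n) = holds_at (ren r a) (ren r n)"
  "ren r (extent a) = extent (ren r a)"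
  "ren r Ninf = Ninf"
  "ren r (rosoliniStructure l P) = rosoliniStructure l (ren r P)"
  by (simp_all add: type_former_defs)

lemma subst_type_formers [simp]:
  "subst s (A \<rightarrow>\<^sub>t B) = subst s A \<rightarrow>\<^sub>t subst s B"
  "subst s (A \<times>\<^sub>t B) = subst s A \<times>\<^sub>t subst s B"
  "subst s (A \<leftrightarrow>\<^sub>t B) = subst s A \<leftrightarrow>\<^sub>t subst s B"
  "subst s (isProp A) = isProp (subst s A)"
  "subst s (isSet A) = isSet (subst s A)"
  "subst s (neg A) = neg (subst s A)"
  "subst s (decidable A) = decidable (subst s A)"
  "subst s Cantor = Cantor"
  "subst s (holds_at a n) = holds_at (subst s a) (subst s n)"
  "subst s (extent a) = extent (subst s a)"
  "subst s Ninf = Ninf"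
  "subst s (rosoliniStructure l P) = rosoliniStructure l (subst s P)"
  by (simp_all add: type_former_defs)


section \<open>Judgements over well-formed contexts\<close>

lemma ctx_drop:
  "\<turnstile> \<Gamma> \<Longrightarrow> \<forall>n. \<turnstile> drop n \<Gamma>"
  "\<Gamma> \<turnstile> a \<^bold>: A \<Longrightarrow> \<forall>n. \<turnstile> drop n \<Gamma>"
  "\<Gamma> \<turnstile> a \<^bold>\<equiv> b \<^bold>: A \<Longrightarrow> \<forall>n. \<turnstile> drop n \<Gamma>"
proof (induction rule: ctx_has_ty_eq_tm.inducts)
  case ctx_nil
  then show ?case by (simp add: ctx_has_ty_eq_tm.ctx_nil)
next
  case (ctx_cons \<Gamma> A l)
  then show ?case by (metis ctx_has_ty_eq_tm.ctx_cons drop_Cons')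
qed (auto, (metis drop_Suc_Cons)+)

lemma ctx_ConsD: "\<turnstile> A # \<Gamma> \<Longrightarrow> \<turnstile> \<Gamma>"
  using ctx_drop(1) by (metis drop_Suc_Cons drop0)

lemma has_ty_ren:
  assumes "\<Gamma> \<turnstile> t \<^bold>: A" "\<turnstile> \<Delta>"
    and "\<And>k. k < length \<Gamma> \<Longrightarrow> \<Delta> \<turnstile> Var (r k) \<^bold>: ren (\<lambda>m. r (m + Suc k)) (\<Gamma> ! k)"
  shows "\<Delta> \<turnstile> ren r t \<^bold>: ren r A"
  using ty_subst[OF assms(1,2), of "\<lambda>k. Var (r k)"] assms(3) by (simp add: subst_Var_ren ren_ren)

text \<open>
  The judgements below hold vacuously over ill-formed contexts, so that type formation has to be
  checked only where a context is extended. Most proof terms are irrelevant for provability and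
  remain implicit in \<open>\<Gamma> \<tturnstile> A\<close>.
\<close>

definition wt :: "tm list \<Rightarrow> tm \<Rightarrow> tm \<Rightarrow> bool" where
  "wt \<Gamma> t A \<longleftrightarrow> (\<turnstile> \<Gamma> \<longrightarrow> \<Gamma> \<turnstile> t \<^bold>: A)"

definition conv :: "tm list \<Rightarrow> tm \<Rightarrow> tm \<Rightarrow> tm \<Rightarrow> bool" where
  "conv \<Gamma> a b A \<longleftrightarrow> (\<turnstile> \<Gamma> \<longrightarrow> \<Gamma> \<turnstile> a \<^bold>\<equiv> b \<^bold>: A)"

definition is_type :: "tm list \<Rightarrow> tm \<Rightarrow> bool" where
  "is_type \<Gamma> A \<longleftrightarrow> (\<exists>l. wt \<Gamma> A (Univ l))"

definition inhabited :: "tm list \<Rightarrow> tm \<Rightarrow> bool"  ("_ \<tturnstile> _" [40, 40] 40) where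
  "\<Gamma> \<tturnstile> A \<longleftrightarrow> (\<exists>t. wt \<Gamma> t A)"

lemma provable_iff_inhabited: "provable A \<longleftrightarrow> [] \<tturnstile> A"
  by (simp add: provable_def inhabited_def wt_def ctx_nil)

lemma inhI: "wt \<Gamma> t A \<Longrightarrow> \<Gamma> \<tturnstile> A"
  by (auto simp: inhabited_def)

lemma is_typeI: "wt \<Gamma> A (Univ l) \<Longrightarrow> is_type \<Gamma> A"
  by (auto simp: is_type_def)

lemma ctx_Cons: "is_type \<Gamma> A \<Longrightarrow> \<turnstile> \<Gamma> \<Longrightarrow> \<turnstile> A # \<Gamma>"
  by (auto simp: is_type_def wt_def intro: ctx_cons)

lemma wt_wk: "wt \<Gamma> t A \<Longrightarrow> wt (B # \<Gamma>) (wk t) (wk A)"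
  unfolding wt_def
proof
  assume "\<turnstile> \<Gamma> \<longrightarrow> \<Gamma> \<turnstile> t \<^bold>: A" and ctx: "\<turnstile> B # \<Gamma>"
  then have "\<Gamma> \<turnstile> t \<^bold>: A" by (simp add: ctx_ConsD)
  then show "B # \<Gamma> \<turnstile> wk t \<^bold>: wk A"
    using ctx by (rule has_ty_ren) (use ty_var[OF ctx] in fastforce)
qed

lemma wt_wk_under:
  assumes type_A: "is_type \<Gamma> A" and wt_t: "wt (A # \<Gamma>) t C"
  shows "wt (wk A # B # \<Gamma>) (wk_under t) (wk_under C)"
  unfolding wt_def
proof
  assume ctx: "\<turnstile> wk A # B # \<Gamma>"
  then have "\<turnstile> A # \<Gamma>" using type_A by (blast dest: ctx_ConsD intro: ctx_Cons)
  with wt_t have "A # \<Gamma> \<turnstile> t \<^bold>: C" by (simp add: wt_def)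
  then show "wk A # B # \<Gamma> \<turnstile> wk_under t \<^bold>: wk_under C"
    using ctx
  proof (rule has_ty_ren)
    fix k assume "k < length (A # \<Gamma>)"
    then show "wk A # B # \<Gamma> \<turnstile> Var (upren Suc k)
        \<^bold>: ren (\<lambda>m. upren Suc (m + Suc k)) ((A # \<Gamma>) ! k)"
      using ty_var[OF ctx, of 0] ty_var[OF ctx, of "Suc k"] by (cases k) (simp_all add: ren_ren)
  qed
qed

lemma wt_inst:
  assumes type_A: "is_type \<Gamma> A" and wt_t: "wt (A # \<Gamma>) t B" and wt_a: "wt \<Gamma> a A"
  shows "wt \<Gamma> (inst t a) (inst B a)"
  unfolding wt_def inst_def
proof
  assume ctx: "\<turnstile> \<Gamma>"
  with type_A wt_t have "A # \<Gamma> \<turnstile> t \<^bold>: B" by (simp add: wt_def ctx_Cons)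
  then show "\<Gamma> \<turnstile> subst (scons a Var) t \<^bold>: subst (scons a Var) B"
    using ctx
  proof (rule ty_subst)
    fix k assume "k < length (A # \<Gamma>)"
    then show "\<Gamma> \<turnstile> scons a Var k \<^bold>: subst (scons a Var) (ren (\<lambda>m. m + Suc k) ((A # \<Gamma>) ! k))"
      using wt_a ctx ty_var[OF ctx, of "k - 1"]
      by (cases k) (simp_all add: wt_def subst_ren subst_Var_ren)
  qed
qed

lemma wt_wk_Univ: "wt \<Gamma> A (Univ l) \<Longrightarrow> wt (B # \<Gamma>) (wk A) (Univ l)"
  using wt_wk[of \<Gamma> A "Univ l"] by simp

lemma is_type_wk: "is_type \<Gamma> A \<Longrightarrow> is_type (B # \<Gamma>) (wk A)"
  by (auto simp: is_type_def intro: wt_wk_Univ)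

lemma is_type_wk_under:
  "is_type \<Gamma> A \<Longrightarrow> is_type (A # \<Gamma>) C \<Longrightarrow> is_type (wk A # B # \<Gamma>) (wk_under C)"
  using wt_wk_under[of \<Gamma> A C "Univ _" B] by (auto simp: is_type_def)

lemma is_type_inst:
  "is_type \<Gamma> A \<Longrightarrow> is_type (A # \<Gamma>) C \<Longrightarrow> wt \<Gamma> a A \<Longrightarrow> is_type \<Gamma> (inst C a)"
  using wt_inst[of \<Gamma> A C "Univ _" a] by (auto simp: is_type_def inst_def)

lemma inh_wk: "\<Gamma> \<tturnstile> A \<Longrightarrow> B # \<Gamma> \<tturnstile> wk A"
  by (auto simp: inhabited_def intro: wt_wk)

lemma inh_wk_under:
  "is_type \<Gamma> A \<Longrightarrow> A # \<Gamma> \<tturnstile> C \<Longrightarrow> wk A # B # \<Gamma> \<tturnstile> wk_under C"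
  by (auto simp: inhabited_def intro: wt_wk_under)

lemma inh_inst: "is_type \<Gamma> A \<Longrightarrow> A # \<Gamma> \<tturnstile> C \<Longrightarrow> wt \<Gamma> a A \<Longrightarrow> \<Gamma> \<tturnstile> inst C a"
  by (auto simp: inhabited_def intro: wt_inst)

lemma inh_conv: "\<Gamma> \<tturnstile> A \<Longrightarrow> conv \<Gamma> A B (Univ l) \<Longrightarrow> \<Gamma> \<tturnstile> B"
  by (auto simp: inhabited_def wt_def conv_def intro: ty_conv)


section \<open>Type inference for neutral terms\<close>

fun lookup :: "tm list \<Rightarrow> nat \<Rightarrow> tm option" where
  "lookup [] k = None"
| "lookup (A # \<Gamma>) 0 = Some (wk A)"
| "lookup (A # \<Gamma>) (Suc k) = map_option wk (lookup \<Gamma> k)"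

fun dest_Pi :: "tm \<Rightarrow> (tm \<times> tm) option" where
  "dest_Pi (Pi A B) = Some (A, B)"
| "dest_Pi _ = None"

fun dest_Sg :: "tm \<Rightarrow> (tm \<times> tm) option" where
  "dest_Sg (Sg A B) = Some (A, B)"
| "dest_Sg _ = None"

text \<open>
  Types are compared syntactically, without conversion, so that the simplifier can evaluate
  \<open>infer\<close>.
\<close>

fun infer :: "tm list \<Rightarrow> tm \<Rightarrow> tm option" where
  "infer \<Gamma> (Var k) = lookup \<Gamma> k"
| "infer \<Gamma> (App f a) = Option.bind (Option.bind (infer \<Gamma> f) dest_Pi)
     (\<lambda>(A, B). if infer \<Gamma> a = Some A then Some (inst B a) else None)"
| "infer \<Gamma> (Fst p) = map_option fst (Option.bind (infer \<Gamma> p) dest_Sg)"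
| "infer \<Gamma> (Snd p) = map_option (\<lambda>(A, B). inst B (Fst p)) (Option.bind (infer \<Gamma> p) dest_Sg)"
| "infer \<Gamma> (Refl a) = map_option (\<lambda>A. Idt A a a) (infer \<Gamma> a)"
| "infer \<Gamma> Zero2 = Some Two"
| "infer \<Gamma> One2 = Some Two"
| "infer \<Gamma> Star = Some Unit"
| "infer \<Gamma> _ = None"

lemma lookup_sound: "\<turnstile> \<Gamma> \<Longrightarrow> lookup \<Gamma> k = Some A \<Longrightarrow> \<Gamma> \<turnstile> Var k \<^bold>: A"
proof (induction \<Gamma> k arbitrary: A rule: lookup.induct)
  case (2 B \<Gamma>)
  then show ?case using ty_var[of "B # \<Gamma>" 0] by simp
next
  case (3 B \<Gamma> k)
  then obtain A' where "lookup \<Gamma> k = Some A'" "A = wk A'" by auto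
  then show ?case using 3 wt_wk[of \<Gamma> "Var k" A' B] by (simp add: wt_def ctx_ConsD)
qed simp

lemma dest_Pi_Some: "dest_Pi F = Some (A, B) \<Longrightarrow> F = Pi A B"
  by (cases F) auto

lemma dest_Sg_Some: "dest_Sg F = Some (A, B) \<Longrightarrow> F = Sg A B"
  by (cases F) auto

lemma infer_sound: "\<turnstile> \<Gamma> \<Longrightarrow> infer \<Gamma> t = Some A \<Longrightarrow> \<Gamma> \<turnstile> t \<^bold>: A"
proof (induction \<Gamma> t arbitrary: A rule: infer.induct)
  case (2 \<Gamma> f a)
  then show ?case
    by (auto split: bind_splits if_splits dest!: dest_Pi_Some intro: ty_App)
qed (auto split: bind_splits dest!: dest_Sg_Some
    intro: lookup_sound ty_Fst ty_Snd ty_Refl ty_Zero2 ty_One2 ty_Star)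

lemma dest_Pi_type_formers [simp]:
  "dest_Pi (A \<rightarrow>\<^sub>t B) = Some (A, wk B)"
  "dest_Pi (neg A) = Some (A, Empty)"
  "dest_Pi (isProp A) = Some (A, Pi (wk A) (Idt (wk (wk A)) v1 v0))"
  "dest_Pi (isSet A) = Some (A, Pi (wk A) (isProp (Idt (wk (wk A)) v1 v0)))"
  "dest_Pi Cantor = Some (Nat, Two)"
  by (simp_all add: type_former_defs)

lemma dest_Sg_type_formers [simp]:
  "dest_Sg (A \<times>\<^sub>t B) = Some (A, wk B)"
  "dest_Sg (A \<leftrightarrow>\<^sub>t B) = Some (A \<rightarrow>\<^sub>t B, wk (B \<rightarrow>\<^sub>t A))"
  "dest_Sg (extent a) = Some (Nat, holds_at (wk a) v0)"
  "dest_Sg Ninf = Some (Cantor, isProp (extent v0))"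
  "dest_Sg (rosoliniStructure l P) = Some (Ninf, Idt (Univ l) (wk P) (extent (Fst v0)))"
  by (simp_all add: times_def iff_def extent_def Ninf_def rosoliniStructure_def)

lemma wt_infer: "infer \<Gamma> t = Some A \<Longrightarrow> wt \<Gamma> t A"
  by (simp add: wt_def infer_sound)

lemma is_type_infer: "infer \<Gamma> A = Some (Univ l) \<Longrightarrow> is_type \<Gamma> A"
  by (auto intro: is_typeI wt_infer)

lemma inh_infer: "infer \<Gamma> t = Some A \<Longrightarrow> \<Gamma> \<tturnstile> A"
  by (auto intro: inhI wt_infer)

lemma inh_v0: "A # \<Gamma> \<tturnstile> wk A"
  by (rule inh_infer[of _ v0]) simp


section \<open>Formation rules\<close>

lemma wt_App: "wt \<Gamma> f (Pi A B) \<Longrightarrow> wt \<Gamma> a A \<Longrightarrow> wt \<Gamma> (App f a) (inst B a)"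
  by (auto simp: wt_def intro: ty_App)

lemma wt_App_arr: "wt \<Gamma> f (A \<rightarrow>\<^sub>t B) \<Longrightarrow> wt \<Gamma> a A \<Longrightarrow> wt \<Gamma> (App f a) B"
  using wt_App[of \<Gamma> f A "wk B" a] by (simp add: arr_def)

lemma wt_holds_at: "wt \<Gamma> a Cantor \<Longrightarrow> wt \<Gamma> n Nat \<Longrightarrow> wt \<Gamma> (holds_at a n) (Univ l)"
  using wt_App_arr[of \<Gamma> a Nat Two n]
  by (auto simp: wt_def Cantor_def holds_at_def intro: ty_Idt ty_Two ty_One2)

lemma wt_Univ_formers:
  "wt \<Gamma> Nat (Univ l)" "wt \<Gamma> Two (Univ l)" "wt \<Gamma> Empty (Univ l)" "wt \<Gamma> Unit (Univ l)"
  "wt \<Gamma> A (Univ l) \<Longrightarrow> wt (A # \<Gamma>) B (Univ l) \<Longrightarrow> wt \<Gamma> (Pi A B) (Univ l)"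
  "wt \<Gamma> A (Univ l) \<Longrightarrow> wt (A # \<Gamma>) B (Univ l) \<Longrightarrow> wt \<Gamma> (Sg A B) (Univ l)"
  "wt \<Gamma> A (Univ l) \<Longrightarrow> wt \<Gamma> B (Univ l) \<Longrightarrow> wt \<Gamma> (Plus A B) (Univ l)"
  "wt \<Gamma> A (Univ l) \<Longrightarrow> wt \<Gamma> a A \<Longrightarrow> wt \<Gamma> b A \<Longrightarrow> wt \<Gamma> (Idt A a b) (Univ l)"
  "wt \<Gamma> A (Univ l) \<Longrightarrow> wt \<Gamma> (Trunc A) (Univ l)"
  by (auto simp: wt_def
      intro: ty_Nat ty_Two ty_Empty ty_Unit ty_Pi ty_Sg ty_Plus ty_Idt ty_Trunc ctx_cons)

lemma wt_Univ_defined: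
  "wt \<Gamma> A (Univ l) \<Longrightarrow> wt \<Gamma> B (Univ l) \<Longrightarrow> wt \<Gamma> (A \<rightarrow>\<^sub>t B) (Univ l)"
  "wt \<Gamma> A (Univ l) \<Longrightarrow> wt \<Gamma> B (Univ l) \<Longrightarrow> wt \<Gamma> (A \<times>\<^sub>t B) (Univ l)"
  "wt \<Gamma> A (Univ l) \<Longrightarrow> wt \<Gamma> B (Univ l) \<Longrightarrow> wt \<Gamma> (A \<leftrightarrow>\<^sub>t B) (Univ l)"
  "wt \<Gamma> A (Univ l) \<Longrightarrow> wt \<Gamma> (isProp A) (Univ l)"
  "wt \<Gamma> Cantor (Univ l)"
  "wt \<Gamma> a Cantor \<Longrightarrow> wt \<Gamma> (extent a) (Univ l)"
  "wt \<Gamma> Ninf (Univ l)"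
  using wt_wk[of \<Gamma> a Cantor Nat]
  by (simp_all add: arr_def times_def iff_def isProp_def extent_def Ninf_def Cantor_def
      wt_Univ_formers wt_wk_Univ wt_infer wt_holds_at)

lemma is_type_common_level:
  assumes "is_type \<Gamma> A" "is_type \<Delta> B"
  shows "\<exists>l. wt \<Gamma> A (Univ l) \<and> wt \<Delta> B (Univ l)"
proof -
  have cumul: "wt \<Theta> C (Univ m)" if "wt \<Theta> C (Univ l)" "l \<le> m" for \<Theta> C l m
    using that(2,1) by (induction m rule: dec_induct) (auto simp: wt_def intro: ty_cumul)
  obtain i j where "wt \<Gamma> A (Univ i)" "wt \<Delta> B (Univ j)"
    using assms by (auto simp: is_type_def)
  then have "wt \<Gamma> A (Univ (max i j))" "wt \<Delta> B (Univ (max i j))"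
    by (auto intro: cumul)
  then show ?thesis by blast
qed

lemma is_type_formers:
  "is_type \<Gamma> (Univ l)" "is_type \<Gamma> Nat" "is_type \<Gamma> Two" "is_type \<Gamma> Empty" "is_type \<Gamma> Unit"
  "is_type \<Gamma> A \<Longrightarrow> is_type (A # \<Gamma>) B \<Longrightarrow> is_type \<Gamma> (Pi A B)"
  "is_type \<Gamma> A \<Longrightarrow> is_type (A # \<Gamma>) B \<Longrightarrow> is_type \<Gamma> (Sg A B)"
  "is_type \<Gamma> A \<Longrightarrow> is_type \<Gamma> B \<Longrightarrow> is_type \<Gamma> (Plus A B)"
  "is_type \<Gamma> A \<Longrightarrow> wt \<Gamma> a A \<Longrightarrow> wt \<Gamma> b A \<Longrightarrow> is_type \<Gamma> (Idt A a b)"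
  "is_type \<Gamma> A \<Longrightarrow> is_type \<Gamma> (Trunc A)"
proof -
  show "is_type \<Gamma> (Univ l)"
    by (rule is_typeI[of _ _ "Suc l"]) (auto simp: wt_def intro: ty_univ)
  show "is_type \<Gamma> (Pi A B)" "is_type \<Gamma> (Sg A B)" if "is_type \<Gamma> A" "is_type (A # \<Gamma>) B"
    using is_type_common_level[OF that] by (auto intro: is_typeI wt_Univ_formers)
  show "is_type \<Gamma> (Plus A B)" if "is_type \<Gamma> A" "is_type \<Gamma> B"
    using is_type_common_level[OF that] by (auto intro: is_typeI wt_Univ_formers)
qed (auto simp: is_type_def intro: wt_Univ_formers)

lemma is_type_defined:
  "is_type \<Gamma> A \<Longrightarrow> is_type \<Gamma> B \<Longrightarrow> is_type \<Gamma> (A \<rightarrow>\<^sub>t B)"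
  "is_type \<Gamma> A \<Longrightarrow> is_type \<Gamma> B \<Longrightarrow> is_type \<Gamma> (A \<times>\<^sub>t B)"
  "is_type \<Gamma> A \<Longrightarrow> is_type \<Gamma> B \<Longrightarrow> is_type \<Gamma> (A \<leftrightarrow>\<^sub>t B)"
  "is_type \<Gamma> A \<Longrightarrow> is_type \<Gamma> (isProp A)"
  "is_type \<Gamma> A \<Longrightarrow> is_type \<Gamma> (isSet A)"
  "is_type \<Gamma> A \<Longrightarrow> is_type \<Gamma> (neg A)"
  "is_type \<Gamma> A \<Longrightarrow> is_type \<Gamma> (decidable A)"
  "is_type \<Gamma> Cantor"
  "wt \<Gamma> a Cantor \<Longrightarrow> wt \<Gamma> n Nat \<Longrightarrow> is_type \<Gamma> (holds_at a n)"
  "wt \<Gamma> a Cantor \<Longrightarrow> is_type \<Gamma> (extent a)"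
  "is_type \<Gamma> Ninf"
  "wt \<Gamma> P (Univ l) \<Longrightarrow> is_type \<Gamma> (rosoliniStructure l P)"
proof -
  have Ninf: "is_type \<Gamma> Ninf" by (rule is_typeI, rule wt_Univ_defined)
  then show "is_type \<Gamma> Ninf" .
  show "is_type \<Gamma> Cantor" by (rule is_typeI, rule wt_Univ_defined)
  show "is_type \<Gamma> (holds_at a n)" if "wt \<Gamma> a Cantor" "wt \<Gamma> n Nat"
    using wt_holds_at[OF that] by (rule is_typeI)
  show "is_type \<Gamma> (extent a)" if "wt \<Gamma> a Cantor"
    using that by (blast intro: is_typeI wt_Univ_defined)
  have "wt (Ninf # \<Gamma>) (extent (Fst v0)) (Univ l)"
    by (simp add: wt_Univ_defined wt_infer)
  with Ninf show "is_type \<Gamma> (rosoliniStructure l P)" if "wt \<Gamma> P (Univ l)"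
    using that by (simp add: rosoliniStructure_def is_type_formers wt_wk_Univ)
qed (simp_all add: arr_def times_def iff_def isProp_def isSet_def neg_def decidable_def
    is_type_formers is_type_wk wt_infer)

lemmas typing = wt_infer wt_wk wt_wk_Univ wt_holds_at wt_Univ_formers wt_Univ_defined
  is_type_infer is_type_wk is_type_formers is_type_defined inst_def inst2_def


section \<open>Inhabitation rules\<close>

lemma wt_Lam: "is_type \<Gamma> A \<Longrightarrow> wt (A # \<Gamma>) b B \<Longrightarrow> wt \<Gamma> (Lam A b) (Pi A B)"
  by (auto simp: wt_def intro: ty_Lam dest: ctx_Cons)

lemma conv_App_Lam:
  "is_type \<Gamma> A \<Longrightarrow> wt (A # \<Gamma>) b B \<Longrightarrow> wt \<Gamma> a A \<Longrightarrow> conv \<Gamma> (App (Lam A b) a) (inst b a) (inst B a)"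
  by (auto simp: wt_def conv_def intro: Pi_beta dest: ctx_Cons)

lemma wt_Pr:
  "is_type \<Gamma> A \<Longrightarrow> is_type (A # \<Gamma>) B \<Longrightarrow> wt \<Gamma> a A \<Longrightarrow> wt \<Gamma> b (inst B a) \<Longrightarrow> wt \<Gamma> (Pr a b) (Sg A B)"
  using ctx_Cons[of \<Gamma> A] by (auto simp: wt_def is_type_def intro: ty_Pr)

lemma wt_Fst: "wt \<Gamma> p (Sg A B) \<Longrightarrow> wt \<Gamma> (Fst p) A"
  by (auto simp: wt_def intro: ty_Fst)

lemma wt_Snd: "wt \<Gamma> p (Sg A B) \<Longrightarrow> wt \<Gamma> (Snd p) (inst B (Fst p))"
  by (auto simp: wt_def intro: ty_Snd)

lemma wt_Refl: "wt \<Gamma> a A \<Longrightarrow> wt \<Gamma> (Refl a) (Idt A a a)"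
  by (auto simp: wt_def intro: ty_Refl)

lemma conv_refl: "wt \<Gamma> a A \<Longrightarrow> conv \<Gamma> a a A"
  by (auto simp: wt_def conv_def intro: eq_refl)

lemma conv_sym: "conv \<Gamma> a b A \<Longrightarrow> conv \<Gamma> b a A"
  by (auto simp: conv_def intro: eq_sym)

lemma conv_Idt:
  assumes "is_type \<Gamma> A" "conv \<Gamma> a a' A" "conv \<Gamma> b b' A"
  shows "\<exists>l. conv \<Gamma> (Idt A a b) (Idt A a' b') (Univ l)"
  using assms by (fastforce simp: is_type_def wt_def conv_def intro: eq_Idt eq_refl)

lemma conv_Pi:
  "is_type \<Gamma> A \<Longrightarrow> conv \<Gamma> A A' (Univ l) \<Longrightarrow> conv (A # \<Gamma>) B B' (Univ l) \<Longrightarrow>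
    conv \<Gamma> (Pi A B) (Pi A' B') (Univ l)"
  by (auto simp: conv_def intro: eq_Pi ctx_Cons)

lemma conv_Trunc: "conv \<Gamma> A A' (Univ l) \<Longrightarrow> conv \<Gamma> (Trunc A) (Trunc A') (Univ l)"
  by (auto simp: conv_def intro: eq_Trunc)

lemma inh_PiI: "is_type \<Gamma> A \<Longrightarrow> A # \<Gamma> \<tturnstile> B \<Longrightarrow> \<Gamma> \<tturnstile> Pi A B"
  by (auto simp: inhabited_def intro: wt_Lam)

lemma inh_PiE: "\<Gamma> \<tturnstile> Pi A B \<Longrightarrow> wt \<Gamma> a A \<Longrightarrow> \<Gamma> \<tturnstile> inst B a"
  by (auto simp: inhabited_def intro: wt_App)

lemma inh_PiD:
  assumes "\<Gamma> \<tturnstile> Pi A B"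
  shows "A # \<Gamma> \<tturnstile> B"
proof -
  have "A # \<Gamma> \<tturnstile> Pi (wk A) (wk_under B)" using inh_wk[OF assms] by simp
  from inh_PiE[OF this, of v0] show ?thesis by (simp add: inst_def wt_infer)
qed

lemma inh_arrI: "is_type \<Gamma> A \<Longrightarrow> A # \<Gamma> \<tturnstile> wk B \<Longrightarrow> \<Gamma> \<tturnstile> A \<rightarrow>\<^sub>t B"
  by (simp add: arr_def inh_PiI)

lemma inh_mp: "\<Gamma> \<tturnstile> A \<rightarrow>\<^sub>t B \<Longrightarrow> \<Gamma> \<tturnstile> A \<Longrightarrow> \<Gamma> \<tturnstile> B"
  by (auto simp: inhabited_def intro: wt_App_arr)

lemma inh_arrD: "\<Gamma> \<tturnstile> A \<rightarrow>\<^sub>t B \<Longrightarrow> A # \<Gamma> \<tturnstile> wk B"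
  by (simp add: arr_def inh_PiD)

lemma inh_arr_trans:
  "is_type \<Gamma> A \<Longrightarrow> \<Gamma> \<tturnstile> A \<rightarrow>\<^sub>t B \<Longrightarrow> \<Gamma> \<tturnstile> B \<rightarrow>\<^sub>t C \<Longrightarrow> \<Gamma> \<tturnstile> A \<rightarrow>\<^sub>t C"
  using inh_wk[of \<Gamma> "B \<rightarrow>\<^sub>t C" A] by (auto intro!: inh_arrI intro: inh_mp inh_arrD)

lemma inh_arr_const:
  assumes "is_type \<Gamma> A" "is_type \<Gamma> B"
  shows "\<Gamma> \<tturnstile> B \<rightarrow>\<^sub>t (A \<rightarrow>\<^sub>t B)"
proof -
  have "wk A # B # \<Gamma> \<tturnstile> wk (wk B)" by (rule inh_infer[of _ v1]) simp
  then show ?thesis using assms by (simp add: inh_arrI is_type_wk)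
qed

lemma inh_arr_bimap:
  assumes type_A: "is_type \<Gamma> A" and type_A': "is_type \<Gamma> A'" and type_B: "is_type \<Gamma> B"
    and pre: "\<Gamma> \<tturnstile> A' \<rightarrow>\<^sub>t A" and post: "\<Gamma> \<tturnstile> B \<rightarrow>\<^sub>t B'"
  shows "\<Gamma> \<tturnstile> (A \<rightarrow>\<^sub>t B) \<rightarrow>\<^sub>t (A' \<rightarrow>\<^sub>t B')"
proof (rule inh_arrI)
  let ?\<Delta> = "(A \<rightarrow>\<^sub>t B) # \<Gamma>"
  have "?\<Delta> \<tturnstile> wk A \<rightarrow>\<^sub>t wk B" by (rule inh_infer[of _ v0]) simp
  moreover have "?\<Delta> \<tturnstile> wk A' \<rightarrow>\<^sub>t wk A" "?\<Delta> \<tturnstile> wk B \<rightarrow>\<^sub>t wk B'"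
    using inh_wk[OF pre] inh_wk[OF post] by simp_all
  ultimately have "?\<Delta> \<tturnstile> wk A' \<rightarrow>\<^sub>t wk B'"
    using is_type_wk[OF type_A'] by (blast intro: inh_arr_trans)
  then show "?\<Delta> \<tturnstile> wk (A' \<rightarrow>\<^sub>t B')" by simp
qed (use type_A type_B in \<open>rule is_type_defined\<close>)

lemma inh_SgI:
  "is_type \<Gamma> A \<Longrightarrow> is_type (A # \<Gamma>) B \<Longrightarrow> wt \<Gamma> a A \<Longrightarrow> \<Gamma> \<tturnstile> inst B a \<Longrightarrow> \<Gamma> \<tturnstile> Sg A B"
  by (auto simp: inhabited_def intro: wt_Pr)

lemma inh_timesI:
  assumes "is_type \<Gamma> A" "is_type \<Gamma> B" "\<Gamma> \<tturnstile> A" "\<Gamma> \<tturnstile> B"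
  shows "\<Gamma> \<tturnstile> A \<times>\<^sub>t B"
  using assms inh_SgI[of \<Gamma> A "wk B"] by (auto simp: times_def inhabited_def is_type_wk)

lemma inh_timesD:
  assumes "\<Gamma> \<tturnstile> A \<times>\<^sub>t B"
  shows "\<Gamma> \<tturnstile> A" "\<Gamma> \<tturnstile> B"
  using assms wt_Fst[of \<Gamma> _ A "wk B"] wt_Snd[of \<Gamma> _ A "wk B"]
  by (auto simp: inhabited_def times_def)

lemma inh_iffI:
  "is_type \<Gamma> A \<Longrightarrow> is_type \<Gamma> B \<Longrightarrow> \<Gamma> \<tturnstile> A \<rightarrow>\<^sub>t B \<Longrightarrow> \<Gamma> \<tturnstile> B \<rightarrow>\<^sub>t A \<Longrightarrow> \<Gamma> \<tturnstile> A \<leftrightarrow>\<^sub>t B"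
  by (simp add: iff_def inh_timesI is_type_defined)

lemma inh_iffD:
  assumes "\<Gamma> \<tturnstile> A \<leftrightarrow>\<^sub>t B"
  shows "\<Gamma> \<tturnstile> A \<rightarrow>\<^sub>t B" "\<Gamma> \<tturnstile> B \<rightarrow>\<^sub>t A"
  using assms by (auto simp: iff_def dest: inh_timesD)

lemma inh_curry:
  assumes type_A: "is_type \<Gamma> A" and type_B: "is_type (A # \<Gamma>) B" and imp: "\<Gamma> \<tturnstile> Sg A B \<rightarrow>\<^sub>t C"
  shows "\<Gamma> \<tturnstile> Pi A (B \<rightarrow>\<^sub>t wk C)"
proof (intro inh_PiI inh_arrI type_A type_B)
  have "B # A # \<Gamma> \<tturnstile> wk (wk (Sg A B))"
    using inh_SgI[of "B # A # \<Gamma>" "wk (wk A)" "wk_under (wk_under B)" v1] type_A type_B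
    by (simp add: typing is_type_wk_under inh_v0)
  with inh_wk[OF inh_wk[OF imp], of B A] show "B # A # \<Gamma> \<tturnstile> wk (wk C)"
    by (auto intro: inh_mp)
qed

lemma inh_uncurry:
  assumes type_A: "is_type \<Gamma> A" and type_B: "is_type (A # \<Gamma>) B" and type_C: "is_type \<Gamma> C"
  shows "\<Gamma> \<tturnstile> Pi A (B \<rightarrow>\<^sub>t wk C) \<rightarrow>\<^sub>t (Sg A B \<rightarrow>\<^sub>t C)"
proof -
  let ?F = "Pi A (B \<rightarrow>\<^sub>t wk C)"
  have "Sg (wk A) (wk_under B) # ?F # \<Gamma> \<tturnstile> wk (wk C)"
    by (rule inh_infer[of _ "App (App v1 (Fst v0)) (Snd v0)"]) (simp add: inst_def)
  then show ?thesis
    using type_A type_B type_C by (simp add: inh_arrI is_type_wk_under typing)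
qed

lemma inh_PlusI:
  assumes "is_type \<Gamma> A" "is_type \<Gamma> B"
  shows "\<Gamma> \<tturnstile> A \<Longrightarrow> \<Gamma> \<tturnstile> Plus A B" "\<Gamma> \<tturnstile> B \<Longrightarrow> \<Gamma> \<tturnstile> Plus A B"
  using assms unfolding inhabited_def is_type_def wt_def by (blast intro: ty_InjL ty_InjR)+

lemma inh_PlusE:
  assumes type_A: "is_type \<Gamma> A" and type_B: "is_type \<Gamma> B" and type_C: "is_type \<Gamma> C"
    and plus: "\<Gamma> \<tturnstile> Plus A B" and "A # \<Gamma> \<tturnstile> wk C" "B # \<Gamma> \<tturnstile> wk C"
  shows "\<Gamma> \<tturnstile> C"
proof -
  obtain c d t where "wt (A # \<Gamma>) c (wk C)" "wt (B # \<Gamma>) d (wk C)" "wt \<Gamma> t (Plus A B)"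
    using assms by (auto simp: inhabited_def)
  moreover obtain l where "wt (Plus A B # \<Gamma>) (wk C) (Univ l)"
    using is_type_wk[OF type_C] by (auto simp: is_type_def)
  ultimately have "wt \<Gamma> (Case (wk C) c d t) (inst (wk C) t)"
    using ctx_Cons[OF type_A] ctx_Cons[OF type_B] ctx_Cons[of \<Gamma> "Plus A B"] type_A type_B
    by (auto simp: wt_def subst_Var_ren is_type_formers simp del: inst_wk intro!: ty_Case)
  then show ?thesis by (auto intro: inhI)
qed

lemma inh_EmptyE:
  assumes "is_type \<Gamma> C" "\<Gamma> \<tturnstile> Empty"
  shows "\<Gamma> \<tturnstile> C"
  using is_type_wk[OF assms(1), of Empty] ctx_Cons[of \<Gamma> Empty] assms(2) is_type_formers
  unfolding inhabited_def is_type_def wt_def by (metis inst_wk ty_Abort)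

lemma wt_TwoInd:
  assumes "is_type (Two # \<Gamma>) C" "wt \<Gamma> c (inst C Zero2)" "wt \<Gamma> d (inst C One2)" "wt \<Gamma> t Two"
  shows "wt \<Gamma> (TwoInd C c d t) (inst C t)"
  using assms ctx_Cons[of \<Gamma> Two] is_type_formers
  unfolding is_type_def wt_def by (blast intro: ty_TwoInd)

lemma conv_TwoInd:
  assumes "is_type (Two # \<Gamma>) C" "wt \<Gamma> c (inst C Zero2)" "wt \<Gamma> d (inst C One2)"
  shows "conv \<Gamma> (TwoInd C c d Zero2) c (inst C Zero2)"
    and "conv \<Gamma> (TwoInd C c d One2) d (inst C One2)"
  using assms ctx_Cons[of \<Gamma> Two] is_type_formers
  unfolding is_type_def wt_def conv_def by (blast intro: Zero2_beta One2_beta)+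

lemma inh_TwoE:
  assumes "is_type (Two # \<Gamma>) C" "\<Gamma> \<tturnstile> inst C Zero2" "\<Gamma> \<tturnstile> inst C One2" "wt \<Gamma> t Two"
  shows "\<Gamma> \<tturnstile> inst C t"
  using assms by (auto simp: inhabited_def intro: wt_TwoInd)

lemma inh_TruncI: "\<Gamma> \<tturnstile> A \<Longrightarrow> \<Gamma> \<tturnstile> Trunc A"
  unfolding inhabited_def wt_def by (blast intro: ty_Inc)


section \<open>Identity types\<close>

lemma ctx_based_path: "is_type \<Gamma> A \<Longrightarrow> wt \<Gamma> a A \<Longrightarrow> \<turnstile> \<Gamma> \<Longrightarrow> \<turnstile> Idt (wk A) (wk a) v0 # A # \<Gamma>"
  by (simp add: ctx_Cons typing)

lemma wt_J:
  assumes "is_type \<Gamma> A" "wt \<Gamma> a A" "wt \<Gamma> b A" "wt \<Gamma> p (Idt A a b)"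
    and "is_type (Idt (wk A) (wk a) v0 # A # \<Gamma>) C" "wt \<Gamma> c (inst2 C a (Refl a))"
  shows "wt \<Gamma> (J A a C c b p) (inst2 C b p)"
  using assms ctx_based_path[OF assms(1,2)] unfolding wt_def is_type_def by (blast intro: ty_J)

lemma conv_J:
  assumes "is_type \<Gamma> A" "wt \<Gamma> a A"
    and "is_type (Idt (wk A) (wk a) v0 # A # \<Gamma>) C" "wt \<Gamma> c (inst2 C a (Refl a))"
  shows "conv \<Gamma> (J A a C c a (Refl a)) c (inst2 C a (Refl a))"
  using assms ctx_based_path[OF assms(1,2)] unfolding wt_def is_type_def conv_def
  by (blast intro: J_beta)

lemma inh_J:
  assumes "is_type \<Gamma> A" "wt \<Gamma> a A" "wt \<Gamma> b A" "wt \<Gamma> p (Idt A a b)"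
    and "is_type (Idt (wk A) (wk a) v0 # A # \<Gamma>) C" "\<Gamma> \<tturnstile> inst2 C a (Refl a)"
  shows "\<Gamma> \<tturnstile> inst2 C b p"
  using assms by (auto simp: inhabited_def intro: wt_J)

lemma inh_transport:
  assumes "is_type \<Gamma> A" "wt \<Gamma> a A" "wt \<Gamma> b A" "\<Gamma> \<tturnstile> Idt A a b"
    and "is_type (A # \<Gamma>) D" "\<Gamma> \<tturnstile> inst D a"
  shows "\<Gamma> \<tturnstile> inst D b"
  using assms inh_J[of \<Gamma> A a b _ "wk D"] by (auto simp: inhabited_def is_type_wk)

lemma inh_Refl: "wt \<Gamma> a A \<Longrightarrow> \<Gamma> \<tturnstile> Idt A a a"
  by (blast intro: inhI wt_Refl)

lemma inh_Idt_conv: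
  assumes "is_type \<Gamma> A" "wt \<Gamma> a A" "conv \<Gamma> a b A"
  shows "\<Gamma> \<tturnstile> Idt A a b"
  using conv_Idt[OF assms(1) conv_refl[OF assms(2)] assms(3)] inh_Refl[OF assms(2)]
  by (auto intro: inh_conv)

lemma inh_sym:
  assumes "is_type \<Gamma> A" "wt \<Gamma> a A" "wt \<Gamma> b A" "\<Gamma> \<tturnstile> Idt A a b"
  shows "\<Gamma> \<tturnstile> Idt A b a"
  using inh_transport[OF assms, of "Idt (wk A) v0 (wk a)"] assms
  by (simp add: typing inh_Refl)

lemma inh_trans:
  assumes "is_type \<Gamma> A" "wt \<Gamma> a A" "wt \<Gamma> b A" "wt \<Gamma> c A" "\<Gamma> \<tturnstile> Idt A a b" "\<Gamma> \<tturnstile> Idt A b c"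
  shows "\<Gamma> \<tturnstile> Idt A a c"
  using inh_transport[OF assms(1,3,4,6), of "Idt (wk A) (wk a) v0"] assms
  by (simp add: typing)

lemma inh_ap:
  assumes type_A: "is_type \<Gamma> A" and wt_a: "wt \<Gamma> a A" and wt_b: "wt \<Gamma> b A"
    and eq: "\<Gamma> \<tturnstile> Idt A a b" and type_B: "is_type \<Gamma> B" and wt_t: "wt (A # \<Gamma>) t (wk B)"
  shows "\<Gamma> \<tturnstile> Idt B (inst t a) (inst t b)"
proof -
  have wt_inst_a: "wt \<Gamma> (inst t a) B" using wt_inst[OF type_A wt_t wt_a] by simp
  then have "is_type (A # \<Gamma>) (Idt (wk B) (wk (inst t a)) t)"
    using type_B wt_t wt_wk[OF wt_inst_a, of A] by (simp add: is_type_formers is_type_wk)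
  from inh_transport[OF type_A wt_a wt_b eq this] show ?thesis
    using inh_Refl[OF wt_inst_a] by (simp add: inst_def)
qed

lemma inh_ap_App:
  assumes "is_type \<Gamma> A" "is_type \<Gamma> B" and wt_f: "wt \<Gamma> f (A \<rightarrow>\<^sub>t B)"
    and "wt \<Gamma> a A" "wt \<Gamma> b A" "\<Gamma> \<tturnstile> Idt A a b"
  shows "\<Gamma> \<tturnstile> Idt B (App f a) (App f b)"
proof -
  have "wt (A # \<Gamma>) (App (wk f) v0) (wk B)"
    using wt_wk[OF wt_f, of A] by (intro wt_App_arr[of _ _ "wk A"]) (simp_all add: wt_infer)
  from inh_ap[OF assms(1,4-6,2) this] show ?thesis by (simp add: inst_def)
qed

lemma inh_happly:
  assumes type_A: "is_type \<Gamma> A" and type_B: "is_type (A # \<Gamma>) B"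
    and wt_f: "wt \<Gamma> f (Pi A B)" and wt_g: "wt \<Gamma> g (Pi A B)" and eq: "\<Gamma> \<tturnstile> Idt (Pi A B) f g"
  shows "\<Gamma> \<tturnstile> Pi A (Idt B (App (wk f) v0) (App (wk g) v0))"
proof -
  let ?D = "Pi (wk A) (Idt (wk_under B) (App (wk (wk f)) v0) (App v1 v0))"
  have app: "wt (A # \<Gamma>) (App (wk f) v0) B"
    using wt_App[of "A # \<Gamma>" "wk f" "wk A" "wk_under B" v0] wt_wk[OF wt_f, of A]
    by (simp add: typing)
  have "is_type (Pi A B # \<Gamma>) ?D"
    using type_A type_B wt_wk_under[OF type_A app] by (simp add: typing is_type_wk_under)
  moreover have "\<Gamma> \<tturnstile> inst ?D f"
    using inh_PiI[OF type_A inh_Refl[OF app]] by (simp add: inst_def)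
  ultimately have "\<Gamma> \<tturnstile> inst ?D g"
    using inh_transport[OF _ wt_f wt_g eq] type_A type_B by (simp add: is_type_formers)
  then show ?thesis by (simp add: inst_def)
qed

lemma inh_funext:
  assumes "is_type \<Gamma> A" "wt \<Gamma> f (Pi A B)" "wt \<Gamma> g (Pi A B)"
    and "A # \<Gamma> \<tturnstile> Idt B (App (wk f) v0) (App (wk g) v0)"
  shows "\<Gamma> \<tturnstile> Idt (Pi A B) f g"
  using inh_PiI[OF assms(1,4)] assms(2,3) unfolding inhabited_def wt_def by (blast intro: ty_Funext)

lemma inh_propext:
  assumes "wt \<Gamma> P (Univ l)" "wt \<Gamma> Q (Univ l)" "\<Gamma> \<tturnstile> isProp P" "\<Gamma> \<tturnstile> isProp Q" "\<Gamma> \<tturnstile> P \<leftrightarrow>\<^sub>t Q"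
  shows "\<Gamma> \<tturnstile> Idt (Univ l) P Q"
  using assms(1-4) inh_iffD[OF assms(5)] unfolding inhabited_def wt_def by (blast intro: ty_Propext)

text \<open>\<open>ldiv A x y z e q\<close> is the path \<open>e\<inverse> \<bullet> q : z = y\<close> for \<open>e : x = z\<close> and \<open>q : x = y\<close>.\<close>

definition ldiv :: "tm \<Rightarrow> tm \<Rightarrow> tm \<Rightarrow> tm \<Rightarrow> tm \<Rightarrow> tm \<Rightarrow> tm" where
  "ldiv A x y z e q = J A x (Idt (wk (wk A)) v1 (wk (wk y))) q z e"

lemma subst_ldiv [simp]:
  "subst s (ldiv A x y z e q) =
     ldiv (subst s A) (subst s x) (subst s y) (subst s z) (subst s e) (subst s q)"
  by (simp add: ldiv_def)

lemma wt_ldiv: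
  assumes "is_type \<Gamma> A" "wt \<Gamma> x A" "wt \<Gamma> y A" "wt \<Gamma> z A" "wt \<Gamma> e (Idt A x z)" "wt \<Gamma> q (Idt A x y)"
  shows "wt \<Gamma> (ldiv A x y z e q) (Idt A z y)"
  using wt_J[OF assms(1,2,4,5), of "Idt (wk (wk A)) v1 (wk (wk y))" q] assms
  by (simp add: typing ldiv_def)

lemma ldiv_self:
  assumes "is_type \<Gamma> A" "wt \<Gamma> x A" "wt \<Gamma> z A" "wt \<Gamma> e (Idt A x z)"
  shows "\<Gamma> \<tturnstile> Idt (Idt A z z) (ldiv A x z z e e) (Refl z)"
proof -
  let ?C = "Idt (Idt (wk (wk A)) v1 v1) (ldiv (wk (wk A)) (wk (wk x)) v1 v1 v0 v0) (Refl v1)"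
  have "is_type (Idt (wk A) (wk x) v0 # A # \<Gamma>) ?C"
    using assms by (simp add: typing wt_ldiv)
  moreover have "conv \<Gamma> (ldiv A x x x (Refl x) (Refl x)) (Refl x) (Idt A x x)"
    using conv_J[of \<Gamma> A x "Idt (wk (wk A)) v1 (wk (wk x))" "Refl x"] assms
    by (simp add: typing wt_Refl ldiv_def)
  then have "\<Gamma> \<tturnstile> inst2 ?C x (Refl x)"
    using inh_Idt_conv[of \<Gamma> "Idt A x x" "ldiv A x x x (Refl x) (Refl x)" "Refl x"] assms
    by (simp add: typing wt_Refl wt_ldiv)
  ultimately have "\<Gamma> \<tturnstile> inst2 ?C z e" by (rule inh_J[OF assms])
  then show ?thesis by (simp add: inst2_def)
qed

lemma inh_ldiv_cong:
  assumes "is_type \<Gamma> A" "wt \<Gamma> x A" "wt \<Gamma> y A" "wt \<Gamma> z A" "wt \<Gamma> e (Idt A x z)"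
    and "wt \<Gamma> q (Idt A x y)" "wt \<Gamma> q' (Idt A x y)" "\<Gamma> \<tturnstile> Idt (Idt A x y) q q'"
  shows "\<Gamma> \<tturnstile> Idt (Idt A z y) (ldiv A x y z e q) (ldiv A x y z e q')"
proof -
  let ?t = "ldiv (wk A) (wk x) (wk y) (wk z) (wk e) v0"
  have "wt (Idt A x y # \<Gamma>) ?t (wk (Idt A z y))"
    using assms wt_wk[OF assms(5), of "Idt A x y"] by (simp add: wt_ldiv typing)
  with assms have "\<Gamma> \<tturnstile> Idt (Idt A z y) (inst ?t q) (inst ?t q')"
    by (intro inh_ap[of _ "Idt A x y"]) (simp_all add: is_type_formers)
  then show ?thesis by (simp add: inst_def)
qed


section \<open>Propositions and sets\<close>

lemma isPropI:
  "is_type \<Gamma> A \<Longrightarrow> wk A # A # \<Gamma> \<tturnstile> Idt (wk (wk A)) v1 v0 \<Longrightarrow> \<Gamma> \<tturnstile> isProp A"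
  by (simp add: isProp_def inh_PiI is_type_wk)

lemma isPropD:
  assumes prop_A: "\<Gamma> \<tturnstile> isProp A" and wt_a: "wt \<Gamma> a A" and wt_b: "wt \<Gamma> b A"
  shows "\<Gamma> \<tturnstile> Idt A a b"
proof -
  have "\<Gamma> \<tturnstile> Pi A (Idt (wk A) (wk a) v0)"
    using inh_PiE[OF prop_A[unfolded isProp_def] wt_a] by (simp add: inst_def)
  from inh_PiE[OF this wt_b] show ?thesis by (simp add: inst_def)
qed

lemma isSetI:
  "is_type \<Gamma> A \<Longrightarrow> wk A # A # \<Gamma> \<tturnstile> isProp (Idt (wk (wk A)) v1 v0) \<Longrightarrow> \<Gamma> \<tturnstile> isSet A"
  by (simp add: isSet_def inh_PiI is_type_wk)

lemma isSetD:
  assumes set_A: "\<Gamma> \<tturnstile> isSet A" and wt_a: "wt \<Gamma> a A" and wt_b: "wt \<Gamma> b A"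
  shows "\<Gamma> \<tturnstile> isProp (Idt A a b)"
proof -
  have "\<Gamma> \<tturnstile> Pi A (isProp (Idt (wk A) (wk a) v0))"
    using inh_PiE[OF set_A[unfolded isSet_def] wt_a] by (simp add: inst_def)
  from inh_PiE[OF this wt_b] show ?thesis by (simp add: inst_def)
qed

lemma isProp_if_inhabited_imp:
  assumes "is_type \<Gamma> A" "A # \<Gamma> \<tturnstile> isProp (wk A)"
  shows "\<Gamma> \<tturnstile> isProp A"
proof (rule isPropI[OF assms(1)])
  have "wk A # A # \<Gamma> \<tturnstile> isProp (wk (wk A))"
    using inh_wk[OF assms(2), of "wk A"] by simp
  then show "wk A # A # \<Gamma> \<tturnstile> Idt (wk (wk A)) v1 v0"
    by (rule isPropD) (simp_all add: typing)
qed

lemma wt_roundtrip: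
  assumes wt_f: "wt \<Gamma> f (Pi A (Idt (wk A) (wk x) v0 \<rightarrow>\<^sub>t R))"
    and wt_h: "wt \<Gamma> h (Pi A (R \<rightarrow>\<^sub>t Idt (wk A) (wk x) v0))"
    and wt_y: "wt \<Gamma> y A" and wt_p: "wt \<Gamma> p (Idt A x y)"
  shows "wt \<Gamma> (App (App f y) p) (inst R y)" "wt \<Gamma> (App (App h y) (App (App f y) p)) (Idt A x y)"
proof -
  have "wt \<Gamma> (App f y) (Idt A x y \<rightarrow>\<^sub>t inst R y)" "wt \<Gamma> (App h y) (inst R y \<rightarrow>\<^sub>t Idt A x y)"
    using wt_App[OF wt_f wt_y] wt_App[OF wt_h wt_y] by (simp_all add: inst_def)
  then show "wt \<Gamma> (App (App f y) p) (inst R y)"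
    and "wt \<Gamma> (App (App h y) (App (App f y) p)) (Idt A x y)"
    using wt_p by (blast intro: wt_App_arr)+
qed

text \<open>By path induction, \<open>h \<circ> f\<close> is \<open>p \<mapsto> h (f refl) \<bullet> p\<close>.\<close>

lemma ldiv_roundtrip:
  fixes f h :: tm
  defines "rt \<equiv> \<lambda>y p. App (App h y) (App (App f y) p)"
  assumes type_A: "is_type \<Gamma> A" and wt_x: "wt \<Gamma> x A"
    and wt_f: "wt \<Gamma> f (Pi A (Idt (wk A) (wk x) v0 \<rightarrow>\<^sub>t R))"
    and wt_h: "wt \<Gamma> h (Pi A (R \<rightarrow>\<^sub>t Idt (wk A) (wk x) v0))"
    and wt_y: "wt \<Gamma> y A" and wt_p: "wt \<Gamma> p (Idt A x y)"
  shows "\<Gamma> \<tturnstile> Idt (Idt A x y) (ldiv A x y x (rt x (Refl x)) (rt y p)) p"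
proof -
  let ?\<Delta> = "Idt (wk A) (wk x) v0 # A # \<Gamma>"
  let ?rt = "App (App (wk (wk h)) v1) (App (App (wk (wk f)) v1) v0)"
  let ?C = "Idt (Idt (wk (wk A)) (wk (wk x)) v1)
    (ldiv (wk (wk A)) (wk (wk x)) v1 (wk (wk x)) (wk (wk (rt x (Refl x)))) ?rt) v0"
  have wt_rt_Refl: "wt \<Gamma> (rt x (Refl x)) (Idt A x x)"
    unfolding rt_def using wt_f wt_h wt_x wt_x[THEN wt_Refl] by (rule wt_roundtrip)
  have "wt ?\<Delta> ?rt (Idt (wk (wk A)) (wk (wk x)) v1)"
    using wt_roundtrip(2)[of ?\<Delta> "wk (wk f)" "wk (wk A)" "wk (wk x)"
        "wk_under (wk_under R)" "wk (wk h)" v1 v0] wt_wk[OF wt_wk[OF wt_f]] wt_wk[OF wt_wk[OF wt_h]]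
    by (simp add: typing)
  then have "is_type ?\<Delta> ?C"
    using type_A wt_x wt_wk[OF wt_wk[OF wt_rt_Refl]] by (simp add: typing wt_ldiv)
  moreover have "\<Gamma> \<tturnstile> inst2 ?C x (Refl x)"
    using ldiv_self[OF type_A wt_x wt_x wt_rt_Refl] by (simp add: typing rt_def)
  ultimately have "\<Gamma> \<tturnstile> inst2 ?C y p" by (rule inh_J[OF type_A wt_x wt_y wt_p])
  then show ?thesis by (simp add: inst2_def rt_def)
qed

lemma fibrewise_map_injective:
  assumes type_A: "is_type \<Gamma> A" and wt_x: "wt \<Gamma> x A" and type_R: "is_type (A # \<Gamma>) R"
    and wt_f: "wt \<Gamma> f (Pi A (Idt (wk A) (wk x) v0 \<rightarrow>\<^sub>t R))"
    and wt_h: "wt \<Gamma> h (Pi A (R \<rightarrow>\<^sub>t Idt (wk A) (wk x) v0))"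
    and wt_y: "wt \<Gamma> y A" and wt_p: "wt \<Gamma> p (Idt A x y)" and wt_q: "wt \<Gamma> q (Idt A x y)"
    and eq: "\<Gamma> \<tturnstile> Idt (inst R y) (App (App f y) p) (App (App f y) q)"
  shows "\<Gamma> \<tturnstile> Idt (Idt A x y) p q"
proof -
  define rt where "rt = (\<lambda>y p. App (App h y) (App (App f y) p))"
  define shift where "shift = (\<lambda>p. ldiv A x y x (rt x (Refl x)) (rt y p))"
  let ?I = "Idt A x y"
  have type_I: "is_type \<Gamma> ?I" using type_A wt_x wt_y by (simp add: typing)
  have type_inst: "is_type \<Gamma> (inst R y)" using type_A type_R wt_y by (rule is_type_inst)
  have wt_rt: "wt \<Gamma> (rt y p) (Idt A x y)" if "wt \<Gamma> y A" "wt \<Gamma> p (Idt A x y)" for y p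
    unfolding rt_def using wt_f wt_h that by (rule wt_roundtrip)
  have wt_rt_Refl: "wt \<Gamma> (rt x (Refl x)) (Idt A x x)"
    using wt_x wt_Refl[OF wt_x] by (rule wt_rt)
  have wt_shift: "wt \<Gamma> (shift r) ?I" if "wt \<Gamma> r ?I" for r
    unfolding shift_def using type_A wt_x wt_y wt_x wt_rt_Refl wt_rt[OF wt_y that] by (rule wt_ldiv)
  have shift: "\<Gamma> \<tturnstile> Idt ?I (shift r) r" if "wt \<Gamma> r ?I" for r
    unfolding shift_def rt_def using type_A wt_x wt_f wt_h wt_y that by (rule ldiv_roundtrip)
  have "wt \<Gamma> (App h y) (inst R y \<rightarrow>\<^sub>t ?I)"
    using wt_App[OF wt_h wt_y] by (simp add: inst_def)
  from inh_ap_App[OF type_inst type_I this _ _ eq] have "\<Gamma> \<tturnstile> Idt ?I (rt y p) (rt y q)"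
    using wt_roundtrip(1)[OF wt_f wt_h wt_y] wt_p wt_q by (simp add: rt_def)
  then have "\<Gamma> \<tturnstile> Idt ?I (shift p) (shift q)"
    unfolding shift_def using type_A wt_x wt_y wt_rt_Refl wt_p wt_q
    by (blast intro: inh_ldiv_cong wt_rt)
  then have "\<Gamma> \<tturnstile> Idt ?I (shift p) q"
    using type_I wt_p wt_q by (blast intro: inh_trans wt_shift shift)
  moreover have "\<Gamma> \<tturnstile> Idt ?I p (shift p)"
    using type_I wt_p by (blast intro: inh_sym wt_shift shift)
  ultimately show ?thesis
    using type_I wt_p wt_q by (blast intro: inh_trans wt_shift)
qed

lemma isProp_Idt_if_prop_family:
  assumes type_A: "is_type \<Gamma> A" and wt_x: "wt \<Gamma> x A" and wt_y: "wt \<Gamma> y A"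
    and type_R: "is_type (A # \<Gamma>) R" and prop_R: "A # \<Gamma> \<tturnstile> isProp R"
    and iff: "A # \<Gamma> \<tturnstile> Idt (wk A) (wk x) v0 \<leftrightarrow>\<^sub>t R"
  shows "\<Gamma> \<tturnstile> isProp (Idt A x y)"
proof (rule isPropI)
  show type_I: "is_type \<Gamma> (Idt A x y)" using type_A wt_x wt_y by (simp add: typing)
  let ?\<Delta> = "Idt (wk A) (wk x) (wk y) # Idt A x y # \<Gamma>"
  obtain f h where wt_f: "wt \<Gamma> f (Pi A (Idt (wk A) (wk x) v0 \<rightarrow>\<^sub>t R))"
    and wt_h: "wt \<Gamma> h (Pi A (R \<rightarrow>\<^sub>t Idt (wk A) (wk x) v0))"
    using inh_iffD[OF iff, THEN inh_PiI[OF type_A]] by (auto simp: inhabited_def)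
  note wt_wk_fh = wt_wk[OF wt_wk[OF wt_f], of "Idt (wk A) (wk x) (wk y)" "Idt A x y", simplified]
    wt_wk[OF wt_wk[OF wt_h], of "Idt (wk A) (wk x) (wk y)" "Idt A x y", simplified]
  have wk_inst: "inst (wk_under (wk_under R)) (wk (wk y)) = wk (wk (inst R y))"
    by (simp add: ren_inst)
  have weakened: "is_type ?\<Delta> (wk (wk A))"
    "wt ?\<Delta> (wk (wk x)) (wk (wk A))" "wt ?\<Delta> (wk (wk y)) (wk (wk A))"
    "wt ?\<Delta> v1 (Idt (wk (wk A)) (wk (wk x)) (wk (wk y)))"
    "wt ?\<Delta> v0 (Idt (wk (wk A)) (wk (wk x)) (wk (wk y)))"
    using type_A wt_x wt_y by (simp_all add: typing)
  have "?\<Delta> \<tturnstile> isProp (wk (wk (inst R y)))"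
    using inh_wk[OF inh_wk[OF inh_inst[OF type_A prop_R wt_y]]] by (simp add: inst_def)
  then have eq: "?\<Delta> \<tturnstile> Idt (wk (wk (inst R y)))
      (App (App (wk (wk f)) (wk (wk y))) v1) (App (App (wk (wk f)) (wk (wk y))) v0)"
    using wt_roundtrip(1)[OF wt_wk_fh weakened(3,4)] wt_roundtrip(1)[OF wt_wk_fh weakened(3,5)]
    by (simp add: isPropD wk_inst)
  have "is_type (wk (wk A) # ?\<Delta>) (wk_under (wk_under R))"
    using type_A type_R by (simp add: is_type_wk is_type_wk_under)
  from fibrewise_map_injective[OF weakened(1,2) this wt_wk_fh weakened(3-5)] eq
  show "wk (Idt A x y) # Idt A x y # \<Gamma> \<tturnstile> Idt (wk (wk (Idt A x y))) v1 v0"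
    by (simp add: wk_inst)
qed

lemma isSet_if_prop_relation:
  assumes type_A: "is_type \<Gamma> A" and type_R: "is_type (wk A # A # \<Gamma>) R"
    and prop_R: "wk A # A # \<Gamma> \<tturnstile> isProp R"
    and iff: "wk A # A # \<Gamma> \<tturnstile> Idt (wk (wk A)) v1 v0 \<leftrightarrow>\<^sub>t R"
  shows "\<Gamma> \<tturnstile> isSet A"
proof (rule isSetI[OF type_A])
  let ?\<Delta> = "wk A # A # \<Gamma>"
  have type_wk_A: "is_type (A # \<Gamma>) (wk A)" using type_A by (rule is_type_wk)
  show "?\<Delta> \<tturnstile> isProp (Idt (wk (wk A)) v1 v0)"
    using isProp_Idt_if_prop_family[of ?\<Delta> "wk (wk A)" v1 v0 "wk_under R"]
      is_type_wk_under[OF type_wk_A type_R]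
      inh_wk_under[OF type_wk_A prop_R] inh_wk_under[OF type_wk_A iff]
    using type_A by (simp add: typing)
qed

lemma isSet_if_isProp:
  assumes type_A: "is_type \<Gamma> A" and prop_A: "\<Gamma> \<tturnstile> isProp A"
  shows "\<Gamma> \<tturnstile> isSet A"
proof (rule isSet_if_prop_relation[OF type_A])
  let ?\<Delta> = "wk A # A # \<Gamma>"
  show "?\<Delta> \<tturnstile> isProp (wk (wk A))"
    using inh_wk[OF inh_wk[OF prop_A], of "wk A" A] by simp
  then have "?\<Delta> \<tturnstile> wk (wk A) \<rightarrow>\<^sub>t Idt (wk (wk A)) v1 v0"
    using type_A by (intro inh_arrI inh_wk isPropD) (simp_all add: typing)
  moreover have "?\<Delta> \<tturnstile> Idt (wk (wk A)) v1 v0 \<rightarrow>\<^sub>t wk (wk A)"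
    using type_A by (intro inh_arrI inh_infer[of _ v1]) (simp_all add: typing)
  ultimately show "?\<Delta> \<tturnstile> Idt (wk (wk A)) v1 v0 \<leftrightarrow>\<^sub>t wk (wk A)"
    using type_A by (simp add: inh_iffI typing)
qed (use type_A in \<open>simp add: typing\<close>)

lemma isProp_Pi:
  assumes type_A: "is_type \<Gamma> A" and type_B: "is_type (A # \<Gamma>) B" and prop_B: "A # \<Gamma> \<tturnstile> isProp B"
  shows "\<Gamma> \<tturnstile> isProp (Pi A B)"
proof -
  let ?\<Delta> = "wk (wk A) # wk (Pi A B) # Pi A B # \<Gamma>"
  let ?B = "wk_under (wk_under B)"
  have "?\<Delta> \<tturnstile> isProp ?B"
    using inh_wk_under[OF _ inh_wk_under[OF type_A prop_B], of "Pi A B" "wk (Pi A B)"] type_A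
    by (simp add: typing)
  then have "?\<Delta> \<tturnstile> Idt ?B (App v2 v0) (App v1 v0)"
    by (rule isPropD) (simp_all add: typing)
  then show ?thesis using type_A type_B
    by (intro isPropI) (simp_all add: typing inh_funext)
qed

lemma isProp_arr:
  "is_type \<Gamma> A \<Longrightarrow> is_type \<Gamma> B \<Longrightarrow> \<Gamma> \<tturnstile> isProp B \<Longrightarrow> \<Gamma> \<tturnstile> isProp (A \<rightarrow>\<^sub>t B)"
  using isProp_Pi[of \<Gamma> A "wk B"] inh_wk[of \<Gamma> "isProp B" A] by (simp add: arr_def is_type_wk)

lemma isProp_Empty: "\<Gamma> \<tturnstile> isProp Empty"
  by (rule isPropI, simp add: typing, rule inh_EmptyE)
    (simp_all add: typing inh_infer[of _ v0])

lemma isProp_neg: "is_type \<Gamma> A \<Longrightarrow> \<Gamma> \<tturnstile> isProp (neg A)"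
  by (simp add: neg_def isProp_arr isProp_Empty typing)

lemma isProp_isProp:
  assumes type_A: "is_type \<Gamma> A"
  shows "\<Gamma> \<tturnstile> isProp (isProp A)"
proof (rule isProp_if_inhabited_imp)
  let ?\<Gamma> = "isProp A # \<Gamma>"
  let ?\<Delta> = "wk (wk A) # wk A # ?\<Gamma>"
  show "is_type \<Gamma> (isProp A)" using type_A by (rule is_type_defined)
  have "?\<Gamma> \<tturnstile> isSet (wk A)"
    using type_A by (intro isSet_if_isProp inh_infer[of _ v0]) (simp_all add: typing)
  then have "?\<Delta> \<tturnstile> isSet (wk (wk (wk A)))"
    using inh_wk[OF inh_wk, of ?\<Gamma> "isSet (wk A)" "wk (wk A)" "wk A"] by simp
  then have "?\<Delta> \<tturnstile> isProp (Idt (wk (wk (wk A))) v1 v0)"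
    by (rule isSetD) (simp_all add: typing)
  then show "?\<Gamma> \<tturnstile> isProp (wk (isProp A))"
    using type_A unfolding ren_type_formers isProp_def[of "wk A"]
    by (intro isProp_Pi) (simp_all add: typing)
qed

lemma inh_ap_Pr:
  assumes type_A: "is_type \<Gamma> A" and type_B: "is_type (A # \<Gamma>) B" and wt_a: "wt \<Gamma> a A"
    and wt_b: "wt \<Gamma> b (inst B a)" and wt_b': "wt \<Gamma> b' (inst B a)" and eq: "\<Gamma> \<tturnstile> Idt (inst B a) b b'"
  shows "\<Gamma> \<tturnstile> Idt (Sg A B) (Pr a b) (Pr a b')"
proof -
  have type_inst: "is_type \<Gamma> (inst B a)" using type_A type_B wt_a by (rule is_type_inst)
  have "wt (inst B a # \<Gamma>) (Pr (wk a) v0) (wk (Sg A B))"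
    using type_A type_B wt_wk[OF wt_a, of "inst B a"]
    by (simp add: wt_Pr is_type_wk is_type_wk_under wt_infer ren_inst)
  from inh_ap[OF type_inst wt_b wt_b' eq _ this] show ?thesis
    using type_A type_B by (simp add: inst_def is_type_formers)
qed

lemma inh_Idt_Pr:
  assumes type_A: "is_type \<Gamma> A" and type_B: "is_type (A # \<Gamma>) B"
    and prop_B: "A # \<Gamma> \<tturnstile> isProp B"
    and wt_a: "wt \<Gamma> a A" and wt_b: "wt \<Gamma> b (inst B a)"
    and wt_a': "wt \<Gamma> a' A" and wt_b': "wt \<Gamma> b' (inst B a')" and eq: "\<Gamma> \<tturnstile> Idt A a a'"
  shows "\<Gamma> \<tturnstile> Idt (Sg A B) (Pr a b) (Pr a' b')"
proof -
  let ?D = "Pi B (Idt (wk (wk (Sg A B))) (wk (wk (Pr a b))) (Pr v1 v0))"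
  have wt_pair: "wt \<Gamma> (Pr a b) (Sg A B)" using type_A type_B wt_a wt_b by (rule wt_Pr)
  have "wt (B # A # \<Gamma>) (Pr v1 v0) (wk (wk (Sg A B)))"
    using type_A type_B by (simp add: wt_Pr typing is_type_wk_under)
  then have type_D: "is_type (A # \<Gamma>) ?D"
    using type_A type_B wt_wk[OF wt_wk[OF wt_pair]] by (simp add: typing is_type_wk_under)
  have type_inst: "is_type \<Gamma> (inst B a)" using type_A type_B wt_a by (rule is_type_inst)
  have "inst B a # \<Gamma> \<tturnstile> isProp (wk (inst B a))"
    using inh_wk[OF inh_inst[OF type_A prop_B wt_a]] by (simp add: inst_def)
  then have "inst B a # \<Gamma> \<tturnstile> Idt (wk (inst B a)) (wk b) v0"
    using wt_b by (intro isPropD) (simp_all add: wt_wk wt_infer)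
  then have "inst B a # \<Gamma> \<tturnstile> Idt (wk (Sg A B)) (wk (Pr a b)) (Pr (wk a) v0)"
    using type_A type_B wt_wk[OF wt_a] wt_wk[OF wt_b]
    by (simp add: inh_ap_Pr is_type_wk is_type_wk_under wt_infer ren_inst)
  then have "\<Gamma> \<tturnstile> inst ?D a"
    using inh_PiI[OF type_inst] by (simp add: inst_def)
  then have "\<Gamma> \<tturnstile> inst ?D a'" by (rule inh_transport[OF type_A wt_a wt_a' eq type_D])
  then have "\<Gamma> \<tturnstile> Pi (inst B a') (Idt (wk (Sg A B)) (wk (Pr a b)) (Pr (wk a') v0))"
    by (simp add: inst_def)
  from inh_PiE[OF this wt_b'] show ?thesis by (simp add: inst_def)
qed

lemma inh_Idt_Sg:
  assumes type_A: "is_type \<Gamma> A" and type_B: "is_type (A # \<Gamma>) B"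
    and prop_B: "A # \<Gamma> \<tturnstile> isProp B"
    and wt_s: "wt \<Gamma> s (Sg A B)" and wt_t: "wt \<Gamma> t (Sg A B)" and eq: "\<Gamma> \<tturnstile> Idt A (Fst s) (Fst t)"
  shows "\<Gamma> \<tturnstile> Idt (Sg A B) s t"
proof -
  have type_Sg: "is_type \<Gamma> (Sg A B)" using type_A type_B by (rule is_type_formers)
  have eta: "conv \<Gamma> (Pr (Fst p) (Snd p)) p (Sg A B)" if "wt \<Gamma> p (Sg A B)" for p
    using that by (auto simp: wt_def conv_def intro: Sg_eta)
  have "\<Gamma> \<tturnstile> Idt (Sg A B) (Pr (Fst s) (Snd s)) (Pr (Fst t) (Snd t))"
    using inh_Idt_Pr[OF type_A type_B prop_B _ _ _ _ eq] wt_s wt_t by (simp add: wt_Fst wt_Snd)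
  with conv_Idt[OF type_Sg eta[OF wt_s] eta[OF wt_t]] show ?thesis by (auto intro: inh_conv)
qed

lemma isProp_times:
  assumes type_A: "is_type \<Gamma> A" and prop_A: "\<Gamma> \<tturnstile> isProp A"
    and type_B: "is_type \<Gamma> B" and prop_B: "\<Gamma> \<tturnstile> isProp B"
  shows "\<Gamma> \<tturnstile> isProp (A \<times>\<^sub>t B)"
proof (rule isPropI)
  let ?\<Delta> = "wk (A \<times>\<^sub>t B) # (A \<times>\<^sub>t B) # \<Gamma>"
  show "is_type \<Gamma> (A \<times>\<^sub>t B)" using type_A type_B by (simp add: is_type_defined)
  have "?\<Delta> \<tturnstile> isProp (wk (wk A))" using inh_wk[OF inh_wk[OF prop_A]] by simp
  then have "?\<Delta> \<tturnstile> Idt (wk (wk A)) (Fst v1) (Fst v0)"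
    by (rule isPropD) (simp_all add: typing)
  moreover have "wk (wk A) # ?\<Delta> \<tturnstile> isProp (wk (wk (wk B)))"
    using inh_wk[OF inh_wk[OF inh_wk[OF prop_B]]] by simp
  ultimately show "?\<Delta> \<tturnstile> Idt (wk (wk (A \<times>\<^sub>t B))) v1 v0"
    using inh_Idt_Sg[of ?\<Delta> "wk (wk A)" "wk (wk (wk B))" v1 v0] type_A type_B
    by (simp add: typing times_def)
qed

lemma isProp_iff:
  "is_type \<Gamma> A \<Longrightarrow> \<Gamma> \<tturnstile> isProp A \<Longrightarrow> is_type \<Gamma> B \<Longrightarrow> \<Gamma> \<tturnstile> isProp B \<Longrightarrow> \<Gamma> \<tturnstile> isProp (A \<leftrightarrow>\<^sub>t B)"
  by (simp add: iff_def isProp_times isProp_arr is_type_defined)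

lemma isSet_Sg:
  assumes type_A: "is_type \<Gamma> A" and type_B: "is_type (A # \<Gamma>) B" and set_A: "\<Gamma> \<tturnstile> isSet A"
    and prop_B: "A # \<Gamma> \<tturnstile> isProp B"
  shows "\<Gamma> \<tturnstile> isSet (Sg A B)"
proof (rule isSet_if_prop_relation)
  let ?S = "Sg A B"
  let ?\<Delta> = "wk ?S # ?S # \<Gamma>"
  let ?R = "Idt (wk (wk A)) (Fst v1) (Fst v0)"
  let ?E = "Idt (wk (wk ?S)) v1 v0"
  show type_S: "is_type \<Gamma> ?S" using type_A type_B by (rule is_type_formers)
  show type_R: "is_type ?\<Delta> ?R" using type_A by (simp add: typing)
  have type_E: "is_type ?\<Delta> ?E"
    using is_type_wk[OF is_type_wk[OF type_S]] by (simp add: typing)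
  have "?\<Delta> \<tturnstile> isSet (wk (wk A))"
    using inh_wk[OF inh_wk[OF set_A]] by simp
  then show "?\<Delta> \<tturnstile> isProp ?R"
    by (rule isSetD) (simp_all add: typing)
  have "?E # ?\<Delta> \<tturnstile> Idt (wk (wk (wk A))) (Fst v2) (Fst v1)"
    using inh_ap[of "?E # ?\<Delta>" "wk (wk (wk ?S))" v2 v1 "wk (wk (wk A))" "Fst v0"]
      is_type_wk[OF is_type_wk[OF is_type_wk[OF type_S]]] type_A
    by (simp add: typing inh_infer[of _ v0])
  moreover have "?R # ?\<Delta> \<tturnstile> Idt (wk (wk (wk ?S))) v2 v1"
    using inh_Idt_Sg[of "?R # ?\<Delta>" "wk (wk (wk A))" "wk_under (wk_under (wk_under B))" v2 v1]
      type_A type_B inh_wk_under[OF _ inh_wk_under[OF _ inh_wk_under[OF type_A prop_B]]]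
    by (simp add: typing is_type_wk_under inh_infer[of _ v0])
  ultimately show "?\<Delta> \<tturnstile> ?E \<leftrightarrow>\<^sub>t ?R"
    using type_E type_R by (simp add: inh_iffI inh_arrI)
qed

lemma isSet_Pi:
  assumes type_A: "is_type \<Gamma> A" and type_B: "is_type (A # \<Gamma>) B" and set_B: "A # \<Gamma> \<tturnstile> isSet B"
  shows "\<Gamma> \<tturnstile> isSet (Pi A B)"
proof (rule isSet_if_prop_relation)
  let ?P = "Pi A B"
  let ?\<Delta> = "wk ?P # ?P # \<Gamma>"
  let ?A = "wk (wk A)" and ?B = "wk_under (wk_under B)"
  let ?R = "Pi ?A (Idt ?B (App v2 v0) (App v1 v0))"
  let ?E = "Idt (wk (wk ?P)) v1 v0"
  show type_P: "is_type \<Gamma> ?P" using type_A type_B by (rule is_type_formers)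
  have type_A': "is_type ?\<Delta> ?A" and type_B': "is_type (?A # ?\<Delta>) ?B"
    using type_A type_B by (simp_all add: is_type_wk is_type_wk_under)
  then show type_R: "is_type ?\<Delta> ?R" by (simp add: typing)
  have type_E: "is_type ?\<Delta> ?E"
    using is_type_wk[OF is_type_wk[OF type_P]] by (simp add: typing)
  have "?A # ?\<Delta> \<tturnstile> isSet ?B"
    using inh_wk_under[OF _ inh_wk_under[OF type_A set_B]] type_A by (simp add: is_type_wk)
  then have "?A # ?\<Delta> \<tturnstile> isProp (Idt ?B (App v2 v0) (App v1 v0))"
    by (rule isSetD) (simp_all add: typing)
  then show "?\<Delta> \<tturnstile> isProp ?R"
    using type_A' type_B' by (intro isProp_Pi) (simp_all add: typing)
  have "?E # ?\<Delta> \<tturnstile> wk ?R"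
    using inh_happly[of "?E # ?\<Delta>" "wk ?A" "wk_under ?B" v2 v1] type_A' type_B'
    by (simp add: typing is_type_wk_under inh_infer[of _ v0])
  moreover have "?R # ?\<Delta> \<tturnstile> wk ?E"
    using inh_funext[of "?R # ?\<Delta>" "wk ?A" v2 "wk_under ?B" v1] type_A'
      inh_infer[of "wk ?A # ?R # ?\<Delta>" "App v1 v0"]
    by (simp add: typing)
  ultimately show "?\<Delta> \<tturnstile> ?E \<leftrightarrow>\<^sub>t ?R"
    using type_E type_R by (simp add: inh_iffI inh_arrI)
qed

lemma inh_negE: "is_type \<Gamma> C \<Longrightarrow> \<Gamma> \<tturnstile> neg A \<Longrightarrow> \<Gamma> \<tturnstile> A \<Longrightarrow> \<Gamma> \<tturnstile> C"
  unfolding neg_def by (blast intro: inh_EmptyE inh_mp)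

lemma inh_neg_negI:
  assumes type_A: "is_type \<Gamma> A"
  shows "\<Gamma> \<tturnstile> A \<rightarrow>\<^sub>t neg (neg A)"
proof -
  have "neg (wk A) # A # \<Gamma> \<tturnstile> Empty"
    by (rule inh_negE[of _ _ "wk (wk A)"])
      (simp_all add: typing inh_infer[of _ v0] inh_infer[of _ v1])
  then show ?thesis
    using type_A by (simp add: inh_arrI neg_def[of "neg _"] typing)
qed

lemma inh_neg_negD_if_decidable:
  assumes type_A: "is_type \<Gamma> A" and dec: "\<Gamma> \<tturnstile> decidable A"
  shows "\<Gamma> \<tturnstile> neg (neg A) \<rightarrow>\<^sub>t A"
proof (rule inh_arrI)
  let ?\<Delta> = "neg (neg A) # \<Gamma>"
  have plus: "?\<Delta> \<tturnstile> Plus (wk A) (neg (wk A))"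
    using inh_wk[OF dec, of "neg (neg A)"] by (simp add: decidable_def)
  have neg_case: "neg (wk A) # ?\<Delta> \<tturnstile> wk (wk A)"
    by (rule inh_negE[of _ _ "neg (wk (wk A))"])
      (use type_A in \<open>simp_all add: typing inh_infer[of _ v0] inh_infer[of _ v1]\<close>)
  show "?\<Delta> \<tturnstile> wk A"
    by (rule inh_PlusE[OF _ _ _ plus inh_v0 neg_case]) (use type_A in \<open>simp_all add: typing\<close>)
qed (use type_A in \<open>simp add: typing\<close>)

lemma isSet_if_decidable_Idt:
  assumes type_A: "is_type \<Gamma> A" and dec: "wk A # A # \<Gamma> \<tturnstile> decidable (Idt (wk (wk A)) v1 v0)"
  shows "\<Gamma> \<tturnstile> isSet A"
proof -
  have "is_type (wk A # A # \<Gamma>) (Idt (wk (wk A)) v1 v0)"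
    using type_A by (simp add: typing)
  with isSet_if_prop_relation[OF type_A, of "neg (neg (Idt (wk (wk A)) v1 v0))"] dec
  show ?thesis
    by (simp add: isProp_neg inh_iffI inh_neg_negI inh_neg_negD_if_decidable is_type_defined)
qed

lemma Zero2_neq_One2: "\<Gamma> \<tturnstile> neg (Idt Two Zero2 One2)"
proof -
  let ?C = "TwoInd (Univ 0) Unit Empty"
  let ?\<Delta> = "Idt Two Zero2 One2 # \<Gamma>"
  have motive: "is_type (Two # \<Theta>) (Univ 0)" "wt \<Theta> Unit (inst (Univ 0) Zero2)"
    "wt \<Theta> Empty (inst (Univ 0) One2)" for \<Theta>
    by (simp_all add: typing)
  have type_C: "is_type (Two # ?\<Delta>) (?C v0)"
    using wt_TwoInd[OF motive, of "Two # ?\<Delta>" v0]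
    by (intro is_typeI[of _ _ 0]) (simp add: typing)
  have conv: "conv ?\<Delta> (?C Zero2) Unit (Univ 0)" "conv ?\<Delta> (?C One2) Empty (Univ 0)"
    using conv_TwoInd[OF motive] by (simp_all add: inst_def)
  have "?\<Delta> \<tturnstile> Unit" by (rule inh_infer[of _ Star]) simp
  then have "?\<Delta> \<tturnstile> ?C Zero2" using conv(1) by (blast intro: inh_conv conv_sym)
  then have "?\<Delta> \<tturnstile> inst (?C v0) One2"
    using inh_transport[OF _ _ _ _ type_C, of Zero2 One2] by (simp add: typing inh_infer[of _ v0])
  then have "?\<Delta> \<tturnstile> ?C One2" by (simp add: inst_def)
  then have "?\<Delta> \<tturnstile> Empty" using conv(2) by (rule inh_conv)
  then show ?thesis unfolding neg_def by (intro inh_arrI) (simp_all add: typing)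
qed

lemma One2_neq_Zero2: "\<Gamma> \<tturnstile> neg (Idt Two One2 Zero2)"
proof -
  have "Idt Two One2 Zero2 # \<Gamma> \<tturnstile> Idt Two Zero2 One2"
    by (rule inh_sym) (simp_all add: typing inh_infer[of _ v0])
  then have "Idt Two One2 Zero2 # \<Gamma> \<tturnstile> Empty"
    using Zero2_neq_One2 by (blast intro: inh_negE is_type_formers)
  then show ?thesis unfolding neg_def by (intro inh_arrI) (simp_all add: typing)
qed

lemma decidable_Idt_Two:
  assumes wt_s: "wt \<Gamma> s Two" and wt_t: "wt \<Gamma> t Two"
  shows "\<Gamma> \<tturnstile> decidable (Idt Two s t)"
proof -
  have endpoints: "\<Gamma> \<tturnstile> decidable (Idt Two Zero2 Zero2)" "\<Gamma> \<tturnstile> decidable (Idt Two One2 One2)"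
    "\<Gamma> \<tturnstile> decidable (Idt Two Zero2 One2)" "\<Gamma> \<tturnstile> decidable (Idt Two One2 Zero2)"
    by (simp_all add: decidable_def inh_PlusI inh_Refl Zero2_neq_One2 One2_neq_Zero2 typing)
  have "\<Gamma> \<tturnstile> decidable (Idt Two Zero2 t)" "\<Gamma> \<tturnstile> decidable (Idt Two One2 t)"
    using inh_TwoE[OF _ _ _ wt_t, of "decidable (Idt Two Zero2 v0)"]
      inh_TwoE[OF _ _ _ wt_t, of "decidable (Idt Two One2 v0)"] endpoints
    by (simp_all add: typing)
  then show ?thesis
    using inh_TwoE[OF _ _ _ wt_s, of "decidable (Idt Two v0 (wk t))"] wt_wk[OF wt_t, of Two]
    by (simp add: typing)
qed

lemma isSet_Two: "\<Gamma> \<tturnstile> isSet Two"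
  by (rule isSet_if_decidable_Idt) (simp_all add: decidable_Idt_Two typing)

lemma isSet_Cantor: "\<Gamma> \<tturnstile> isSet Cantor"
  using isSet_Pi[of \<Gamma> Nat Two] by (simp add: Cantor_def arr_def isSet_Two is_type_formers)

lemma isSet_Ninf: "\<Gamma> \<tturnstile> isSet Ninf"
  unfolding Ninf_def by (rule isSet_Sg) (simp_all add: isSet_Cantor isProp_isProp typing)


section \<open>Truncations\<close>

lemma wt_Squash: "wt \<Gamma> x (Trunc A) \<Longrightarrow> wt \<Gamma> y (Trunc A) \<Longrightarrow> wt \<Gamma> (Squash x y) (Idt (Trunc A) x y)"
  by (auto simp: wt_def intro: ty_Squash)

lemma isProp_Trunc:
  assumes "is_type \<Gamma> A"
  shows "\<Gamma> \<tturnstile> isProp (Trunc A)"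
proof (rule isPropI)
  show "wk (Trunc A) # Trunc A # \<Gamma> \<tturnstile> Idt (wk (wk (Trunc A))) v1 v0"
    by (rule inhI[of _ "Squash v1 v0"]) (simp add: wt_Squash wt_infer)
qed (use assms in \<open>rule is_type_formers\<close>)

lemma wt_TruncRec:
  "is_type \<Gamma> B \<Longrightarrow> wt \<Gamma> h (isProp B) \<Longrightarrow> wt \<Gamma> f (A \<rightarrow>\<^sub>t B) \<Longrightarrow> wt \<Gamma> x (Trunc A) \<Longrightarrow>
    wt \<Gamma> (TruncRec B h f x) B"
  by (auto simp: is_type_def wt_def intro: ty_TruncRec)

lemma inh_TruncE:
  assumes type_A: "is_type \<Gamma> A" and type_C: "is_type \<Gamma> C" and prop_C: "\<Gamma> \<tturnstile> isProp C"
    and trunc: "\<Gamma> \<tturnstile> Trunc A" and imp: "A # \<Gamma> \<tturnstile> wk C"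
  shows "\<Gamma> \<tturnstile> C"
  using type_C prop_C trunc inh_arrI[OF type_A imp] by (auto simp: inhabited_def intro: wt_TruncRec)

lemma inh_Trunc_map:
  assumes type_A: "is_type \<Gamma> A" and type_B: "is_type \<Gamma> B" and imp: "\<Gamma> \<tturnstile> A \<rightarrow>\<^sub>t B"
  shows "\<Gamma> \<tturnstile> Trunc A \<rightarrow>\<^sub>t Trunc B"
proof (rule inh_arrI)
  let ?\<Delta> = "Trunc A # \<Gamma>"
  have "wk A # ?\<Delta> \<tturnstile> wk (wk B)"
    using inh_arrD[OF inh_wk[OF imp, of "Trunc A", simplified]] .
  then have "?\<Delta> \<tturnstile> Trunc (wk B)"
    by - (rule inh_TruncE[of _ "wk A"];
        use type_A type_B in \<open>simp add: typing isProp_Trunc inh_TruncI inh_infer[of _ v0]\<close>)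
  then show "?\<Delta> \<tturnstile> wk (Trunc B)" by simp
qed (use type_A in \<open>simp add: typing\<close>)

lemma inh_Trunc_arr_if_decidable:
  assumes type_A: "is_type \<Gamma> A" and type_B: "is_type \<Gamma> B" and dec: "\<Gamma> \<tturnstile> decidable A"
    and imp: "\<Gamma> \<tturnstile> A \<rightarrow>\<^sub>t Trunc B"
  shows "\<Gamma> \<tturnstile> Trunc (A \<rightarrow>\<^sub>t B)"
proof (rule inh_PlusE[OF _ _ _ dec[unfolded decidable_def]])
  have "A # \<Gamma> \<tturnstile> Trunc (wk B) \<rightarrow>\<^sub>t Trunc (wk A \<rightarrow>\<^sub>t wk B)"
    using type_A type_B by (simp add: inh_Trunc_map inh_arr_const typing)
  then show "A # \<Gamma> \<tturnstile> wk (Trunc (A \<rightarrow>\<^sub>t B))"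
    using inh_arrD[OF imp] by (auto intro: inh_mp)
  have "wk A # neg A # \<Gamma> \<tturnstile> wk (wk B)"
    by (rule inh_negE[of _ _ "wk (wk A)"])
      (use type_B in \<open>simp_all add: typing inh_infer[of _ v0] inh_infer[of _ v1]\<close>)
  then show "neg A # \<Gamma> \<tturnstile> wk (Trunc (A \<rightarrow>\<^sub>t B))"
    using type_A by (simp add: inh_TruncI inh_arrI typing)
qed (use type_A type_B in \<open>simp_all add: typing\<close>)

lemma inh_Trunc_arr_if_Trunc_decidable:
  assumes type_A: "is_type \<Gamma> A" and type_B: "is_type \<Gamma> B" and dec: "\<Gamma> \<tturnstile> Trunc (decidable A)"
    and imp: "\<Gamma> \<tturnstile> A \<rightarrow>\<^sub>t Trunc B"
  shows "\<Gamma> \<tturnstile> Trunc (A \<rightarrow>\<^sub>t B)"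
proof (rule inh_TruncE[OF _ _ _ dec])
  have "decidable A # \<Gamma> \<tturnstile> Trunc (wk A \<rightarrow>\<^sub>t wk B)"
    by (rule inh_Trunc_arr_if_decidable)
      (use type_A type_B inh_wk[OF imp, of "decidable A"] in
        \<open>simp_all add: typing inh_infer[of _ v0]\<close>)
  then show "decidable A # \<Gamma> \<tturnstile> wk (Trunc (A \<rightarrow>\<^sub>t B))" by simp
qed (use type_A type_B in \<open>simp_all add: isProp_Trunc typing\<close>)


section \<open>Small Rosolini structures\<close>

lemma inh_iff_if_Idt:
  assumes wt_P: "wt \<Gamma> P (Univ l)" and wt_Q: "wt \<Gamma> Q (Univ l)" and eq: "\<Gamma> \<tturnstile> Idt (Univ l) P Q"
  shows "\<Gamma> \<tturnstile> P \<leftrightarrow>\<^sub>t Q"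
proof -
  have "is_type \<Gamma> P" using wt_P by (rule is_typeI)
  then have "\<Gamma> \<tturnstile> P \<leftrightarrow>\<^sub>t P" "is_type (Univ l # \<Gamma>) (wk P \<leftrightarrow>\<^sub>t v0)"
    by (simp_all add: inh_iffI inh_arrI inh_v0 typing)
  then show ?thesis
    using inh_transport[OF _ wt_P wt_Q eq, of "wk P \<leftrightarrow>\<^sub>t v0"] by (simp add: typing)
qed

lemma isProp_if_Idt:
  assumes wt_P: "wt \<Gamma> P (Univ l)" and wt_Q: "wt \<Gamma> Q (Univ l)" and eq: "\<Gamma> \<tturnstile> Idt (Univ l) P Q"
    and prop_Q: "\<Gamma> \<tturnstile> isProp Q"
  shows "\<Gamma> \<tturnstile> isProp P"
  using inh_transport[OF _ wt_Q wt_P inh_sym[OF _ wt_P wt_Q eq], of "isProp v0"] prop_Q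
  by (simp add: typing)

definition smallRosolini :: "tm \<Rightarrow> tm" where
  "smallRosolini Q = Sg Ninf (isProp (wk Q) \<times>\<^sub>t (wk Q \<leftrightarrow>\<^sub>t extent (Fst v0)))"

lemma smallRosolini_simps [simp]:
  "ren r (smallRosolini Q) = smallRosolini (ren r Q)"
  "subst s (smallRosolini Q) = smallRosolini (subst s Q)"
  "dest_Sg (smallRosolini Q) = Some (Ninf, isProp (wk Q) \<times>\<^sub>t (wk Q \<leftrightarrow>\<^sub>t extent (Fst v0)))"
  by (simp_all add: smallRosolini_def)

lemma wt_smallRosolini: "wt \<Gamma> Q (Univ l) \<Longrightarrow> wt \<Gamma> (smallRosolini Q) (Univ l)"
  by (simp add: smallRosolini_def typing)

lemma rosoliniStructure_if_small:
  assumes wt_Q: "wt \<Gamma> Q (Univ l)"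
  shows "\<Gamma> \<tturnstile> smallRosolini Q \<rightarrow>\<^sub>t rosoliniStructure l Q"
proof (rule inh_arrI)
  let ?\<Delta> = "smallRosolini Q # \<Gamma>"
  show "is_type \<Gamma> (smallRosolini Q)" using wt_smallRosolini[OF wt_Q] by (rule is_typeI)
  have "?\<Delta> \<tturnstile> Idt (Univ l) (wk Q) (extent (Fst (Fst v0)))"
    using wt_Q inh_infer[of ?\<Delta> "Fst (Snd v0)"] inh_infer[of ?\<Delta> "Snd (Fst v0)"]
      inh_infer[of ?\<Delta> "Snd (Snd v0)"]
    by (intro inh_propext) (simp_all add: typing)
  then show "?\<Delta> \<tturnstile> wk (rosoliniStructure l Q)"
    using wt_Q inh_SgI[of ?\<Delta> Ninf "Idt (Univ l) (wk (wk Q)) (extent (Fst v0))" "Fst v0"]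
    by (simp add: typing flip: rosoliniStructure_def)
qed

lemma small_if_rosoliniStructure:
  assumes wt_Q: "wt \<Gamma> Q (Univ l)"
  shows "\<Gamma> \<tturnstile> rosoliniStructure l Q \<rightarrow>\<^sub>t smallRosolini Q"
proof (rule inh_arrI)
  let ?\<Delta> = "rosoliniStructure l Q # \<Gamma>"
  let ?E = "extent (Fst (Fst v0))"
  show "is_type \<Gamma> (rosoliniStructure l Q)" using wt_Q by (rule is_type_defined)
  have wt_wk_Q: "wt ?\<Delta> (wk Q) (Univ l)" and wt_E: "wt ?\<Delta> ?E (Univ l)"
    using wt_Q by (simp_all add: typing)
  have eq: "?\<Delta> \<tturnstile> Idt (Univ l) (wk Q) ?E" by (rule inh_infer[of _ "Snd v0"]) (simp add: typing)
  have "?\<Delta> \<tturnstile> isProp ?E" by (rule inh_infer[of _ "Snd (Fst v0)"]) (simp add: typing)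
  then have "?\<Delta> \<tturnstile> isProp (wk Q) \<times>\<^sub>t (wk Q \<leftrightarrow>\<^sub>t ?E)"
    using isProp_if_Idt[OF wt_wk_Q wt_E eq] inh_iff_if_Idt[OF wt_wk_Q wt_E eq]
      is_typeI[OF wt_wk_Q] is_typeI[OF wt_E]
    by (simp add: inh_timesI is_type_defined)
  then show "?\<Delta> \<tturnstile> wk (smallRosolini Q)"
    using is_typeI[OF wt_Q]
      inh_SgI[of ?\<Delta> Ninf "isProp (wk (wk Q)) \<times>\<^sub>t (wk (wk Q) \<leftrightarrow>\<^sub>t extent (Fst v0))" "Fst v0"]
    by (simp add: typing flip: smallRosolini_def)
qed

lemma isSet_smallRosolini:
  assumes type_Q: "is_type \<Gamma> Q"
  shows "\<Gamma> \<tturnstile> isSet (smallRosolini Q)"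
  unfolding smallRosolini_def
proof (rule isSet_Sg[OF _ _ isSet_Ninf])
  let ?B = "isProp (wk Q) \<times>\<^sub>t (wk Q \<leftrightarrow>\<^sub>t extent (Fst v0))"
  let ?\<Delta> = "?B # Ninf # \<Gamma>"
  show type_B: "is_type (Ninf # \<Gamma>) ?B" using type_Q by (simp add: typing)
  have "?\<Delta> \<tturnstile> isProp (extent (Fst v1))" by (rule inh_infer[of _ "Snd v1"]) (simp add: typing)
  moreover have "?\<Delta> \<tturnstile> isProp (wk (wk Q))" by (rule inh_infer[of _ "Fst v0"]) simp
  ultimately have "?\<Delta> \<tturnstile> isProp (wk ?B)"
    using type_Q by (simp add: isProp_times isProp_iff isProp_isProp typing)
  then show "Ninf # \<Gamma> \<tturnstile> isProp ?B" by (rule isProp_if_inhabited_imp[OF type_B])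
qed (rule is_type_defined)


section \<open>The choice principles\<close>

definition extent_choice :: "nat \<Rightarrow> tm list \<Rightarrow> bool" where
  "extent_choice l \<Gamma> \<longleftrightarrow> (\<forall>\<alpha> B. wt \<Gamma> \<alpha> Cantor \<longrightarrow> \<Gamma> \<tturnstile> isProp (extent \<alpha>) \<longrightarrow>
     wt \<Gamma> B (Univ l) \<longrightarrow> \<Gamma> \<tturnstile> isSet B \<longrightarrow> \<Gamma> \<tturnstile> extent \<alpha> \<rightarrow>\<^sub>t Trunc B \<longrightarrow> \<Gamma> \<tturnstile> Trunc (extent \<alpha> \<rightarrow>\<^sub>t B))"

lemma rosolini_choice_if_extent_choice:
  assumes choice: "extent_choice l \<Gamma>" and wt_P: "wt \<Gamma> P (Univ l)" and wt_Q: "wt \<Gamma> Q (Univ l)"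
    and wt_r: "wt \<Gamma> r (rosoliniStructure l P)" and imp: "\<Gamma> \<tturnstile> P \<rightarrow>\<^sub>t Trunc (rosoliniStructure l Q)"
  shows "\<Gamma> \<tturnstile> Trunc (P \<rightarrow>\<^sub>t rosoliniStructure l Q)"
proof -
  let ?u = "Fst r"
  let ?\<alpha> = "Fst ?u"
  let ?E = "extent ?\<alpha>" and ?S = "smallRosolini Q"
  have wt_u: "wt \<Gamma> ?u Ninf" using wt_r by (auto simp: rosoliniStructure_def intro: wt_Fst)
  then have wt_\<alpha>: "wt \<Gamma> ?\<alpha> Cantor" by (auto simp: Ninf_def intro: wt_Fst)
  have prop_E: "\<Gamma> \<tturnstile> isProp ?E"
    using wt_Snd[OF wt_u[unfolded Ninf_def]] by (auto simp: inst_def intro: inhI)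
  have eq: "\<Gamma> \<tturnstile> Idt (Univ l) P ?E"
    using wt_Snd[OF wt_r[unfolded rosoliniStructure_def]] by (auto simp: inst_def intro: inhI)
  have wt_E: "wt \<Gamma> ?E (Univ l)" and wt_S: "wt \<Gamma> ?S (Univ l)"
    using wt_\<alpha> wt_Q by (simp_all add: typing wt_smallRosolini)
  note types = wt_P[THEN is_typeI] wt_Q[THEN is_typeI] wt_E[THEN is_typeI] wt_S[THEN is_typeI]
  note P_iff_E = inh_iff_if_Idt[OF wt_P wt_E eq]
  have "\<Gamma> \<tturnstile> P \<rightarrow>\<^sub>t Trunc ?S"
    using inh_arr_trans[OF _ imp inh_Trunc_map[OF _ _ small_if_rosoliniStructure[OF wt_Q]]]
    using types wt_Q by (simp add: is_type_defined)
  then have "\<Gamma> \<tturnstile> ?E \<rightarrow>\<^sub>t Trunc ?S"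
    by (rule inh_arr_trans[OF types(3) inh_iffD(2)[OF P_iff_E]])
  then have "\<Gamma> \<tturnstile> Trunc (?E \<rightarrow>\<^sub>t ?S)"
    using choice wt_\<alpha> prop_E wt_S isSet_smallRosolini[OF types(2)] by (simp add: extent_choice_def)
  moreover have "\<Gamma> \<tturnstile> (?E \<rightarrow>\<^sub>t ?S) \<rightarrow>\<^sub>t (P \<rightarrow>\<^sub>t rosoliniStructure l Q)"
    using types inh_iffD(1)[OF P_iff_E] rosoliniStructure_if_small[OF wt_Q]
    by (simp add: inh_arr_bimap is_type_defined)
  then have "\<Gamma> \<tturnstile> Trunc (?E \<rightarrow>\<^sub>t ?S) \<rightarrow>\<^sub>t Trunc (P \<rightarrow>\<^sub>t rosoliniStructure l Q)"
    using types wt_Q by (simp add: inh_Trunc_map is_type_defined)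
  ultimately show ?thesis by (blast intro: inh_mp)
qed

lemmas principle_defs = CountableChoice_def SemidecidableChoice_def LPO_def WLPO_def
  TruncatedWLPO_def PropositionalChoice_def RosoliniChoice_def

lemmas principle_unfold = principle_defs[unfolded Let_def One_nat_def numeral_2_eq_2]

lemma ren_principles [simp]:
  "ren r (CountableChoice l) = CountableChoice l"
  "ren r (SemidecidableChoice l) = SemidecidableChoice l"
  "ren r LPO = LPO" "ren r WLPO = WLPO" "ren r TruncatedWLPO = TruncatedWLPO"
  "ren r (PropositionalChoice l) = PropositionalChoice l"
  by (simp_all add: principle_unfold)

lemma wt_zero_sequence: "wt \<Gamma> (Lam Nat Zero2) Cantor"
  using wt_Lam[of \<Gamma> Nat Zero2 Two] by (simp add: typing Cantor_def arr_def)

lemma is_type_principles: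
  "is_type \<Gamma> (CountableChoice l)" "is_type \<Gamma> (SemidecidableChoice l)"
  "is_type \<Gamma> LPO" "is_type \<Gamma> WLPO" "is_type \<Gamma> TruncatedWLPO" "is_type \<Gamma> (PropositionalChoice l)"
  by (simp_all add: principle_unfold wt_zero_sequence typing)

lemma CountableChoiceD:
  assumes choice: "\<Gamma> \<tturnstile> CountableChoice l" and wt_B: "wt (Nat # \<Gamma>) B (Univ l)"
    and inh: "\<Gamma> \<tturnstile> Pi Nat (Trunc B)"
  shows "\<Gamma> \<tturnstile> Trunc (Pi Nat B)"
proof -
  let ?Y = "Lam Nat B"
  have wt_Y: "wt \<Gamma> ?Y (Nat \<rightarrow>\<^sub>t Univ l)"
    using wt_Lam[OF _ wt_B] by (simp add: typing arr_def)
  have beta: "conv (Nat # \<Gamma>) (App (wk ?Y) v0) B (Univ l)"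
    using conv_App_Lam[of "Nat # \<Gamma>" Nat "wk_under B" "Univ l" v0] wt_wk_under[OF _ wt_B, of Nat]
    by (simp add: typing)
  have "conv \<Gamma> (Pi Nat (Trunc B)) (Pi Nat (Trunc (App (wk ?Y) v0))) (Univ l)"
    "conv \<Gamma> (Trunc (Pi Nat (App (wk ?Y) v0))) (Trunc (Pi Nat B)) (Univ l)"
    using beta beta[THEN conv_sym] by (simp_all add: conv_Pi conv_Trunc conv_refl typing)
  moreover from inh_PiE[OF choice[unfolded principle_unfold] wt_Y]
  have "\<Gamma> \<tturnstile> Pi Nat (Trunc (App (wk ?Y) v0)) \<rightarrow>\<^sub>t Trunc (Pi Nat (App (wk ?Y) v0))"
    by (simp add: inst_def)
  ultimately show ?thesis
    using inh by (blast intro: inh_mp inh_conv)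
qed

lemma SemidecidableChoice_if_CountableChoice:
  assumes choice: "\<Gamma> \<tturnstile> CountableChoice l"
  shows "\<Gamma> \<tturnstile> SemidecidableChoice l"
proof -
  let ?F = "holds_at v1 v0 \<rightarrow>\<^sub>t v2"
  let ?\<Delta> = "Pi Nat (Trunc ?F) # Cantor # Univ l # \<Gamma>"
  have "?\<Delta> \<tturnstile> CountableChoice l"
    using inh_wk[OF inh_wk[OF inh_wk[OF choice]]] by simp
  then have "?\<Delta> \<tturnstile> Trunc (Pi Nat (holds_at v2 v0 \<rightarrow>\<^sub>t v3))"
    by (rule CountableChoiceD) (simp_all add: typing inh_infer[of _ v0])
  then show ?thesis
    by (simp add: principle_unfold inh_PiI inh_arrI typing)
qed

lemma SemidecidableChoiceD:
  assumes choice: "\<Gamma> \<tturnstile> SemidecidableChoice l"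
    and wt_B: "wt \<Gamma> B (Univ l)" and wt_\<alpha>: "wt \<Gamma> \<alpha> Cantor"
    and imp: "\<Gamma> \<tturnstile> Pi Nat (Trunc (holds_at (wk \<alpha>) v0 \<rightarrow>\<^sub>t wk B))"
  shows "\<Gamma> \<tturnstile> Trunc (Pi Nat (holds_at (wk \<alpha>) v0 \<rightarrow>\<^sub>t wk B))"
proof -
  have "\<Gamma> \<tturnstile> Pi Cantor (Pi Nat (Trunc (holds_at v1 v0 \<rightarrow>\<^sub>t wk (wk B))) \<rightarrow>\<^sub>t
      Trunc (Pi Nat (holds_at v1 v0 \<rightarrow>\<^sub>t wk (wk B))))"
    using inh_PiE[OF choice[unfolded principle_unfold] wt_B] by (simp add: inst_def)
  from inh_PiE[OF this wt_\<alpha>] imp show ?thesis by (simp add: inst_def inh_mp)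
qed

lemma extent_choice_if_SemidecidableChoice:
  assumes choice: "\<Gamma> \<tturnstile> SemidecidableChoice l"
  shows "extent_choice l \<Gamma>"
  unfolding extent_choice_def
proof (intro allI impI)
  fix \<alpha> B
  assume wt_\<alpha>: "wt \<Gamma> \<alpha> Cantor" and wt_B: "wt \<Gamma> B (Univ l)"
    and imp: "\<Gamma> \<tturnstile> extent \<alpha> \<rightarrow>\<^sub>t Trunc B"
  let ?H = "holds_at (wk \<alpha>) v0"
  have type_B: "is_type \<Gamma> B" using wt_B by (rule is_typeI)
  have wt_wk_\<alpha>: "wt (Nat # \<Gamma>) (wk \<alpha>) Cantor" using wt_wk[OF wt_\<alpha>] by simp
  then have type_H: "is_type (Nat # \<Gamma>) ?H" by (simp add: typing)
  have "Nat # \<Gamma> \<tturnstile> decidable ?H"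
    using wt_App_arr[of "Nat # \<Gamma>" "wk \<alpha>" Nat Two v0] wt_wk_\<alpha>
    by (simp add: holds_at_def Cantor_def decidable_Idt_Two typing)
  moreover have "Nat # \<Gamma> \<tturnstile> ?H \<rightarrow>\<^sub>t Trunc (wk B)"
    using inh_PiD[OF inh_curry[OF _ type_H imp[unfolded extent_def]]] by (simp add: typing)
  ultimately have "Nat # \<Gamma> \<tturnstile> Trunc (?H \<rightarrow>\<^sub>t wk B)"
    using type_H is_type_wk[OF type_B] by (simp add: inh_Trunc_arr_if_decidable)
  then have "\<Gamma> \<tturnstile> Trunc (Pi Nat (?H \<rightarrow>\<^sub>t wk B))"
    using SemidecidableChoiceD[OF choice wt_B wt_\<alpha>] by (simp add: inh_PiI is_type_formers)
  moreover have "\<Gamma> \<tturnstile> Trunc (Pi Nat (?H \<rightarrow>\<^sub>t wk B)) \<rightarrow>\<^sub>t Trunc (extent \<alpha> \<rightarrow>\<^sub>t B)"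
    using inh_uncurry[of \<Gamma> Nat ?H B] type_B type_H wt_\<alpha>
    by (intro inh_Trunc_map) (simp_all add: typing extent_def)
  ultimately show "\<Gamma> \<tturnstile> Trunc (extent \<alpha> \<rightarrow>\<^sub>t B)" by (blast intro: inh_mp)
qed

lemma extent_choice_if_TruncatedWLPO:
  assumes wlpo: "\<Gamma> \<tturnstile> TruncatedWLPO"
  shows "extent_choice l \<Gamma>"
  unfolding extent_choice_def
proof (intro allI impI)
  fix \<alpha> B
  assume wt_\<alpha>: "wt \<Gamma> \<alpha> Cantor" and wt_B: "wt \<Gamma> B (Univ l)"
    and imp: "\<Gamma> \<tturnstile> extent \<alpha> \<rightarrow>\<^sub>t Trunc B"
  have "\<Gamma> \<tturnstile> Trunc (decidable (extent \<alpha>))"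
    using inh_PiE[OF wlpo[unfolded principle_unfold] wt_\<alpha>] by (simp add: inst_def decidable_def)
  then show "\<Gamma> \<tturnstile> Trunc (extent \<alpha> \<rightarrow>\<^sub>t B)"
    using is_typeI[OF wt_B] wt_\<alpha> imp
    by (intro inh_Trunc_arr_if_Trunc_decidable) (simp_all add: is_type_defined)
qed

lemma TruncatedWLPO_if_WLPO: "\<Gamma> \<tturnstile> WLPO \<Longrightarrow> \<Gamma> \<tturnstile> TruncatedWLPO"
  by (simp add: principle_unfold inh_PiI inh_TruncI inh_PiD is_type_defined)

lemma neg_extent_zero_sequence: "\<Gamma> \<tturnstile> neg (extent (Lam Nat Zero2))"
proof -
  let ?Z = "Lam Nat Zero2"
  let ?\<Delta> = "extent ?Z # \<Gamma>"
  have "conv ?\<Delta> (App ?Z (Fst v0)) Zero2 Two"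
    using conv_App_Lam[of ?\<Delta> Nat Zero2 Two "Fst v0"] by (simp add: typing)
  then obtain l where "conv ?\<Delta> (holds_at ?Z (Fst v0)) (Idt Two Zero2 One2) (Univ l)"
    using conv_Idt[of ?\<Delta> Two _ _ One2 One2] by (auto simp: holds_at_def conv_refl typing)
  moreover have "?\<Delta> \<tturnstile> holds_at ?Z (Fst v0)" by (rule inh_infer[of _ "Snd v0"]) (simp add: inst_def)
  ultimately have "?\<Delta> \<tturnstile> Idt Two Zero2 One2" by (blast intro: inh_conv)
  then have "?\<Delta> \<tturnstile> Empty"
    using Zero2_neq_One2 by (blast intro: inh_negE is_type_formers)
  then show ?thesis
    by (simp add: neg_def inh_arrI is_type_defined wt_zero_sequence)
qed

lemma WLPO_if_LPO:
  assumes lpo: "\<Gamma> \<tturnstile> LPO"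
  shows "\<Gamma> \<tturnstile> WLPO"
proof -
  let ?\<Delta> = "Cantor # \<Gamma>"
  let ?E = "extent v0" and ?eq = "Idt Cantor v0 (Lam Nat Zero2)"
  note [simp] = typing wt_zero_sequence
  have plus: "?\<Delta> \<tturnstile> Plus ?E ?eq"
    using lpo[unfolded principle_unfold] by (rule inh_PiD)
  have "?eq # ?\<Delta> \<tturnstile> Idt Cantor (Lam Nat Zero2) v1"
    by (rule inh_sym) (simp_all add: inh_infer[of _ v0])
  then have "?eq # ?\<Delta> \<tturnstile> neg (extent v1)"
    using inh_transport[of "?eq # ?\<Delta>" Cantor "Lam Nat Zero2" v1 "neg (extent v0)"]
    by (simp add: neg_extent_zero_sequence)
  then have zero_case: "?eq # ?\<Delta> \<tturnstile> wk (Plus ?E (neg ?E))"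
    by (simp add: inh_PlusI(2))
  have extent_case: "?E # ?\<Delta> \<tturnstile> wk (Plus ?E (neg ?E))"
    using inh_v0[of ?E ?\<Delta>] by (simp add: inh_PlusI(1))
  have "?\<Delta> \<tturnstile> Plus ?E (neg ?E)"
    by (rule inh_PlusE[OF _ _ _ plus extent_case zero_case]) simp_all
  then show ?thesis by (simp add: principle_unfold inh_PiI)
qed

lemma extent_choice_if_PropositionalChoice:
  assumes choice: "\<Gamma> \<tturnstile> PropositionalChoice l"
  shows "extent_choice l \<Gamma>"
  unfolding extent_choice_def
proof (intro allI impI)
  fix \<alpha> B
  assume wt_\<alpha>: "wt \<Gamma> \<alpha> Cantor" and prop_E: "\<Gamma> \<tturnstile> isProp (extent \<alpha>)"
    and wt_B: "wt \<Gamma> B (Univ l)" and set_B: "\<Gamma> \<tturnstile> isSet B" and imp: "\<Gamma> \<tturnstile> extent \<alpha> \<rightarrow>\<^sub>t Trunc B"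
  let ?E = "extent \<alpha>"
  have "wt \<Gamma> ?E (Univ l)" using wt_\<alpha> by (rule wt_Univ_defined)
  from inh_PiE[OF choice[unfolded principle_unfold] this]
  have "\<Gamma> \<tturnstile> Pi (Univ l)
      (isSet v0 \<rightarrow>\<^sub>t isProp (wk ?E) \<rightarrow>\<^sub>t (wk ?E \<rightarrow>\<^sub>t Trunc v0) \<rightarrow>\<^sub>t Trunc (wk ?E \<rightarrow>\<^sub>t v0))"
    by (simp add: inst_def)
  from inh_PiE[OF this wt_B]
  have "\<Gamma> \<tturnstile> isSet B \<rightarrow>\<^sub>t isProp ?E \<rightarrow>\<^sub>t (?E \<rightarrow>\<^sub>t Trunc B) \<rightarrow>\<^sub>t Trunc (?E \<rightarrow>\<^sub>t B)"
    by (simp add: inst_def)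
  with set_B prop_E imp show "\<Gamma> \<tturnstile> Trunc (?E \<rightarrow>\<^sub>t B)" by (blast intro: inh_mp)
qed

lemma provable_RosoliniChoice:
  assumes type_X: "is_type [] X" and closed: "\<And>r. ren r X = X"
    and choice: "\<And>\<Gamma>. \<Gamma> \<tturnstile> X \<Longrightarrow> extent_choice l \<Gamma>"
  shows "provable (X \<rightarrow>\<^sub>t RosoliniChoice l)"
proof -
  let ?\<Gamma> = "[v2 \<rightarrow>\<^sub>t Trunc (rosoliniStructure l v1), Trunc (rosoliniStructure l v1),
    Univ l, Univ l, X]"
  let ?G = "v3 \<rightarrow>\<^sub>t rosoliniStructure l v2"
  let ?\<Delta> = "rosoliniStructure l v3 # ?\<Gamma>"
  have "?\<Delta> \<tturnstile> X"
    by (rule inh_infer[of _ "Var 5"]) (simp add: closed numeral_eq_Suc)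
  then have "extent_choice l ?\<Delta>" by (rule choice)
  then have "?\<Delta> \<tturnstile> wk (Trunc ?G)"
    using rosolini_choice_if_extent_choice[of l ?\<Delta> "wk v3" v3 v0]
    by (simp add: typing inh_infer[of _ v1])
  then have "?\<Gamma> \<tturnstile> Trunc ?G"
    by - (rule inh_TruncE[of _ "rosoliniStructure l v3"];
      simp add: isProp_Trunc typing inh_infer[of _ v1])
  then show ?thesis using type_X
    by (simp add: provable_iff_inhabited principle_unfold isRosolini_def typing inh_arrI inh_PiI)
qed

theorem theorem5p33:
  fixes l :: nat
  shows "provable (CountableChoice l \<rightarrow>\<^sub>t RosoliniChoice l)
       \<and> provable (SemidecidableChoice l \<rightarrow>\<^sub>t RosoliniChoice l)
       \<and> provable (LPO \<rightarrow>\<^sub>t RosoliniChoice l)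
       \<and> provable (WLPO \<rightarrow>\<^sub>t RosoliniChoice l)
       \<and> provable (TruncatedWLPO \<rightarrow>\<^sub>t RosoliniChoice l)
       \<and> provable (PropositionalChoice l \<rightarrow>\<^sub>t RosoliniChoice l)"
proof (intro conjI)
  note principles = is_type_principles ren_principles
  show "provable (CountableChoice l \<rightarrow>\<^sub>t RosoliniChoice l)"
    by (intro provable_RosoliniChoice principles
        extent_choice_if_SemidecidableChoice SemidecidableChoice_if_CountableChoice)
  show "provable (SemidecidableChoice l \<rightarrow>\<^sub>t RosoliniChoice l)"
    by (intro provable_RosoliniChoice principles extent_choice_if_SemidecidableChoice)
  show "provable (LPO \<rightarrow>\<^sub>t RosoliniChoice l)"
    by (intro provable_RosoliniChoice principles
        extent_choice_if_TruncatedWLPO TruncatedWLPO_if_WLPO WLPO_if_LPO)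
  show "provable (WLPO \<rightarrow>\<^sub>t RosoliniChoice l)"
    by (intro provable_RosoliniChoice principles
        extent_choice_if_TruncatedWLPO TruncatedWLPO_if_WLPO)
  show "provable (TruncatedWLPO \<rightarrow>\<^sub>t RosoliniChoice l)"
    by (intro provable_RosoliniChoice principles extent_choice_if_TruncatedWLPO)
  show "provable (PropositionalChoice l \<rightarrow>\<^sub>t RosoliniChoice l)"
    by (intro provable_RosoliniChoice principles extent_choice_if_PropositionalChoice)
qed

end
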